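(* Let the network, the pressure law, the systems (S), (R), (Diff) (each for the two components $+,-$), the numbers $\mu^v\in[0,1]$, the perturbations $Z^e_\pm$, and the weights $h^e_\pm$ with $B^e_\pm>0$ be as described in the context. Let $M>0$ and let $(J^e_+,J^e_-)_{e\in E}$ be a classical steady state of (S) such that on $[0,L^e]$, for all $e\in E$, $$\lambda_+(J^e_+,J^e_-)>0,\quad \lambda_-(J^e_+,J^e_-)<0,\quad |J^e_+-J^e_-|>0,\quad |J^e_+-J^e_-|\le M.$$ Let $T>0$. For all $e\in E$ let initial states $y^e_+,y^e_-,z^e_+,z^e_-\in C^1([0,L^e])$ be given such that at all nodes $v\in V$ the $C^1$-compatibility conditions are satisfied. Assume that (S) and (R) have classical solutions $S=(S_+,S_-)$, $R=(R_+,R_-)$ on $[0,T]$ such that for all $e\in E$ $$\|S^e_\pm-J^e_\pm\|_{C^1([0,T]\times[0,L^e])}\le M,\qquad \|R^e_\pm-J^e_\pm\|_{C^1([0,T]\times[0,L^e])}\le M,$$ and that there exist numbers $\hat M>0$, $c>0$, $\varepsilon_0>0$ such that for all $e\in E$ on $[0,T]\times[0,L^e]$ $$|\partial_xS^e_\pm|\le\hat M,\qquad \tfrac34c\le\lambda_+(R^e_+,R^e_-)\le\tfrac54c,\qquad -\tfrac54c\le\lambda_-(R^e_+,R^e_-)\le-\tfrac34c,\qquad |\partial_x(\lambda_\pm(R^e_+,R^e_-))|\le\varepsilon_0 .$$ Assume that there are a nonempty compact convex set $\mathcal U\subset\mathbb R^2$ containing all values of $(S^e_+,S^e_-)$ and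 $(R^e_+,R^e_-)$ ($e\in E$) and a number $\beta>0$ such that $$\max_{\tilde R\in\mathcal U}\{|\partial_{R_+}\lambda_\pm(\tilde R)|,\,|\partial_{R_-}\lambda_\pm(\tilde R)|\}\le\beta .$$ Then on $[0,T]$ there exists a classical solution $(\delta_+,\delta_-)$ of (Diff). Moreover, let $\psi\in(0,\infty)$ be such that for all $e\in E$ $$\varepsilon_0+(12\,\nu^eM+4\,\beta\hat M)\,\kappa^e<\tfrac34\,\psi\,c ,$$ assume that for every $v\in V$ the number $\mu^v\in[0,1]$ is so small that for all $t\in[0,T]$ $$\underline C^v(t)-2\,\overline C^v(t)\,\hat C^v\,|\mu^v|^2\ge0,$$ and assume that for all $t\in[0,T]$ $$\sum_{v\in V}2\,\|Z^v_{out}(t)\|^2\le\eta_\sigma .$$ Then there exist constants $C_1>0$, $\chi>0$ such that for all $t\in[0,T]$ $$\sum_{e\in E}\int_0^{L^e}|\delta^e_+(t,x)|^2+|\delta^e_-(t,x)|^2\,dx\le C_1e^{-\chi t}\sum_{e\in E}\int_0^{L^e}|\delta^e_+(0,x)|^2+|\delta^e_-(0,x)|^2\,dx+C_1\frac{\eta_\sigma}{\chi}.$$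
   Context: Network. $G=(V,E)$ is a finite graph; edge $e\in E$ is identified with $[0,L^e]$, $L^e>0$, and has diameter $D^e>0$ and friction coefficient $\lambda^e_{fric}>0$; $\theta^e=\lambda^e_{fric}/D^e$, $\nu^e=\theta^e/8$. For $v\in V$, $E_0(v)$ is the set of edges incident to $v$, and $x^e(v)\in\{0,L^e\}$ is the end of $[0,L^e]$ corresponding to $v$ for $e\in E_0(v)$. Eigenvalues. The pressure law $p$ is a strictly increasing function of the density, with $p'>0$ and smooth enough that the functions below are $C^1$. With $\tilde R(\rho)=\int_1^\rho\frac{\sqrt{p'(r)}}r\,dr$ put $$\lambda_\pm(R_+,R_-)=\tfrac{R_+-R_-}2\pm\sqrt{p'\big(\tilde R^{-1}(\tfrac{R_++R_-}2)\big)} .$$ All states are assumed to take values in the domain where this is defined. Let $\sigma^e(a,b)=\nu^e|a-b|(a-b)$. Node notation. For a pair $(R_+,R_-)$ of functions on the network and $e\in E_0(v)$: if $x^e(v)=0$ then $R^e_{in}(t,x^e(v))=R^e_-(t,0)$, $R^e_{out}(t,x^e(v))=R^e_+(t,0)$; if $x^e(v)=L^e$ then $R^e_{in}(t,x^e(v))=R^e_+(t,L^e)$, $R^e_{out}(t,x^e(v))=R^e_-(t,L^e)$. $R^v_{in}(t),R^v_{out}(t)\in\mathbb R^{|E_0(v)|}$ are the vectors of these values; the same notation is used for $S,\delta,J,Z$. $\|\cdot\|$ is the Euclidean norm. For $|E_0(v)|\ge2$, with $\omega_v=2/\sum_{f\in E_0(v)}(D^f)^2$, $$K^{v,e}_\sigma(R_+,R_-,t)=-R^e_{in}(t,x^e(v))+\omega_v\sum_{g\in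 E_0(v)}(D^g)^2R^g_{in}(t,x^g(v)).$$ For $|E_0(v)|=1$ put $K^{v,e}_\sigma(R_+,R_-,t)=R^e_{in}(t,x^e(v))$. Systems. Numbers $\mu^v\in[0,1]$ ($v\in V$), boundary data $u^v_\sigma\in C^1([0,T])$ (for $|E_0(v)|=1$) and measurement perturbations $Z^e_\pm(\cdot,x^e(v))\in C^1([0,T])$ are given. (S): $S^e_\pm(0,x)=y^e_\pm(x)$; at $v$ with $|E_0(v)|=1$: $S^e_{out}=(1-\mu^v)u^v_\sigma+\mu^vS^e_{in}$ at $x^e(v)$; at $v$ with $|E_0(v)|\ge2$: $S^e_{out}(t,x^e(v))=K^{v,e}_\sigma(S_+,S_-,t)$; and on $[0,T]\times[0,L^e]$ $$\partial_tS^e_\pm+\lambda_\pm(S^e_+,S^e_-)\,\partial_xS^e_\pm=\mp\sigma^e(S^e_+,S^e_-).$$ (R): $R^e_\pm(0,x)=z^e_\pm(x)$; at $v$ with $|E_0(v)|=1$: $R^e_{out}=(1-\mu^v)[u^v_\sigma+Z^e_{out}]+\mu^vR^e_{in}$; at $v$ with $|E_0(v)|\ge2$: $R^e_{out}=\mu^vK^{v,e}_\sigma(R_+,R_-,t)+(1-\mu^v)[S^e_{out}+Z^e_{out}]$ (all at $(t,x^e(v))$); the same PDE as in (S) with $R$ in place of $S$. (Diff), for $\delta=R-S$: $\delta^e_\pm(0,x)=z^e_\pm(x)-y^e_\pm(x)$; at every $v\in V$: $\delta^e_{out}(t,x^e(v))=\mu^vK^{v,e}_\sigma(\delta_+,\delta_-,t)+(1-\mu^v)Z^e_{out}(t,x^e(v))$;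 and $$\partial_t\delta^e_\pm+\lambda_\pm(S^e+\delta^e)\,\partial_x\delta^e_\pm+[\lambda_\pm(S^e+\delta^e)-\lambda_\pm(S^e)]\,\partial_xS^e_\pm=\mp[\sigma^e(S^e+\delta^e)-\sigma^e(S^e)].$$ Classical solutions are $C^1$ functions on $[0,T]\times[0,L^e]$ satisfying all equations. A classical steady state of (S) is a time-independent $C^1$ solution of the PDE and node conditions of (S) (with time-independent boundary data). $C^1$-compatibility means: the node conditions hold at $t=0$ for the initial data, and so do the node conditions differentiated once in $t$, with time derivatives of the state at $t=0$ expressed by the PDE. Weights and constants. For fixed real numbers $B^e_\pm>0$ let $h^e_+(x)=B^e_+e^{-\psi x}$, $h^e_-(x)=B^e_-e^{\psi x}$, and $$\kappa^e=\max_{z\in[0,L^e]}\Big\{\frac{h^e_+(z)}{h^e_-(z)},\frac{h^e_-(z)}{h^e_+(z)}\Big\}.$$ Let $I_L(v)=\{e\in E_0(v):x^e(v)=L^e\}$, $I_0(v)=\{e\in E_0(v):x^e(v)=0\}$. With $R=S+\delta$, $$\underline C^v(t)=\min\Big\{\min_{e\in I_L(v)}h^e_+(L^e)\lambda_+(R^e)(t,L^e),\ \min_{e\in I_0(v)}h^e_-(0)|\lambda_-(R^e)(t,0)|\Big\},$$ $$\overline C^v(t)=\max\Big\{\max_{e\in I_L(v)}h^e_-(L^e)|\lambda_-(R^e)(t,L^e)|,\ \max_{e\in I_0(v)}h^e_+(0)\lambda_+(R^e)(t,0)\Big\}$$ (extrema over empty sets are omitted). $\hat C^v$ is a constant such that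 $\sum_{e\in E_0(v)}|K^{v,e}_\sigma(\delta_+,\delta_-,t)|^2\le\hat C^v\|\delta^v_{in}(t)\|^2$ for all values of $\delta^v_{in}(t)$. *)

theory Defs
  imports "HOL-Analysis.Analysis" "Graph_Theory.Digraph"
begin

text \<open>
  The identification of an edge \<open>e\<close> with the interval from \<open>0\<close> to \<open>len e\<close> orients it: its tail is
  the end \<open>x = 0\<close> and its head the end \<open>x = len e\<close>. Loops are excluded, since the end \<open>x\<^sup>e(v)\<close> of
  \<open>e\<close> at \<open>v\<close> has to be unique; parallel edges are allowed.
\<close>

record ('v, 'e) network =
  graph :: "('v, 'e) pre_digraph"
  len :: "'e \<Rightarrow> real"
  diam :: "'e \<Rightarrow> real"
  fric :: "'e \<Rightarrow> real"

abbreviation nodes :: "('v, 'e) network \<Rightarrow> 'v set" where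
  "nodes N \<equiv> verts (graph N)"

abbreviation edges :: "('v, 'e) network \<Rightarrow> 'e set" where
  "edges N \<equiv> arcs (graph N)"

definition valid_network :: "('v, 'e) network \<Rightarrow> bool" where
  "valid_network N \<longleftrightarrow> fin_digraph (graph N) \<and> loopfree_digraph (graph N) \<and>
     (\<forall>e\<in>edges N. 0 < len N e \<and> 0 < diam N e \<and> 0 < fric N e)"

definition theta :: "('v, 'e) network \<Rightarrow> 'e \<Rightarrow> real" where
  "theta N e = fric N e / diam N e"

definition nu :: "('v, 'e) network \<Rightarrow> 'e \<Rightarrow> real" where
  "nu N e = theta N e / 8"

definition E0 :: "('v, 'e) network \<Rightarrow> 'v \<Rightarrow> 'e set" where
  "E0 N v = {e \<in> edges N. tail (graph N) e = v \<or> head (graph N) e = v}"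

definition xend :: "('v, 'e) network \<Rightarrow> 'v \<Rightarrow> 'e \<Rightarrow> real" where
  "xend N v e = (if tail (graph N) e = v then 0 else len N e)"

definition I_L :: "('v, 'e) network \<Rightarrow> 'v \<Rightarrow> 'e set" where
  "I_L N v = {e \<in> E0 N v. xend N v e = len N e}"

definition I_0 :: "('v, 'e) network \<Rightarrow> 'v \<Rightarrow> 'e set" where
  "I_0 N v = {e \<in> E0 N v. xend N v e = 0}"


text \<open>
  Densities range over \<open>{0<..}\<close>. Given that \<open>p'\<close> is continuous and positive, \<open>\<lambda>\<^sub>\<plusminus>\<close> below is \<open>C\<^sup>1\<close>
  on its domain if and only if \<open>p'\<close> is \<open>C\<^sup>1\<close>.
\<close>

definition pressure_law :: "(real \<Rightarrow> real) \<Rightarrow> bool" where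
  "pressure_law p \<longleftrightarrow> strict_mono_on {0<..} p \<and>
     (\<forall>\<rho>>0. p differentiable at \<rho> \<and> 0 < deriv p \<rho>) \<and>
     deriv p C1_differentiable_on {0<..}"

definition Rtilde :: "(real \<Rightarrow> real) \<Rightarrow> real \<Rightarrow> real" where
  "Rtilde p \<rho> = (LBINT r=ereal 1..ereal \<rho>. sqrt (deriv p r) / r)"

definition Rtilde_inv :: "(real \<Rightarrow> real) \<Rightarrow> real \<Rightarrow> real" where
  "Rtilde_inv p = inv_into {0<..} (Rtilde p)"

text \<open>A state \<open>(R\<^sub>+, R\<^sub>-)\<close> is a pair: \<open>fst\<close> is the component \<open>+\<close>, \<open>snd\<close> the component \<open>-\<close>.\<close>

definition state_domain :: "(real \<Rightarrow> real) \<Rightarrow> (real \<times> real) set" where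
  "state_domain p = {r. (fst r + snd r) / 2 \<in> Rtilde p ` {0<..}}"

definition lam_p :: "(real \<Rightarrow> real) \<Rightarrow> real \<times> real \<Rightarrow> real" where
  "lam_p p r = (fst r - snd r) / 2 + sqrt (deriv p (Rtilde_inv p ((fst r + snd r) / 2)))"

definition lam_m :: "(real \<Rightarrow> real) \<Rightarrow> real \<times> real \<Rightarrow> real" where
  "lam_m p r = (fst r - snd r) / 2 - sqrt (deriv p (Rtilde_inv p ((fst r + snd r) / 2)))"

definition sigma :: "('v, 'e) network \<Rightarrow> 'e \<Rightarrow> real \<times> real \<Rightarrow> real" where
  "sigma N e r = nu N e * \<bar>fst r - snd r\<bar> * (fst r - snd r)"


text \<open>
  \<open>C\<^sup>1\<close> on a closed interval or rectangle is meant with one-sided derivatives at the boundary.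
\<close>

definition C1_on :: "real \<Rightarrow> real \<Rightarrow> (real \<Rightarrow> 'a::real_normed_vector) \<Rightarrow> bool" where
  "C1_on a b f \<longleftrightarrow> (\<exists>f'. continuous_on {a..b} f' \<and>
     (\<forall>x\<in>{a..b}. (f has_vector_derivative f' x) (at x within {a..b})))"

definition C1_rect :: "real \<Rightarrow> real \<Rightarrow> (real \<Rightarrow> real \<Rightarrow> 'a::real_normed_vector) \<Rightarrow> bool" where
  "C1_rect T l F \<longleftrightarrow> (\<exists>Ft Fx.
     continuous_on ({0..T} \<times> {0..l}) (\<lambda>(t, x). Ft t x) \<and>
     continuous_on ({0..T} \<times> {0..l}) (\<lambda>(t, x). Fx t x) \<and>
     (\<forall>t\<in>{0..T}. \<forall>x\<in>{0..l}.
        ((\<lambda>s. F s x) has_vector_derivative Ft t x) (at t within {0..T}) \<and>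
        ((\<lambda>y. F t y) has_vector_derivative Fx t x) (at x within {0..l})))"

definition dt :: "real \<Rightarrow> (real \<Rightarrow> real \<Rightarrow> 'a::real_normed_vector) \<Rightarrow> real \<Rightarrow> real \<Rightarrow> 'a" where
  "dt T F t x = vector_derivative (\<lambda>s. F s x) (at t within {0..T})"

definition dx :: "real \<Rightarrow> (real \<Rightarrow> real \<Rightarrow> 'a::real_normed_vector) \<Rightarrow> real \<Rightarrow> real \<Rightarrow> 'a" where
  "dx l F t x = vector_derivative (\<lambda>y. F t y) (at x within {0..l})"

definition C1_norm :: "real \<Rightarrow> real \<Rightarrow> (real \<Rightarrow> real \<Rightarrow> real) \<Rightarrow> real" where
  "C1_norm T l f = (SUP (t, x)\<in>{0..T} \<times> {0..l}. max \<bar>f t x\<bar> (max \<bar>dt T f t x\<bar> \<bar>dx l f t x\<bar>))"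


text \<open>
  A function on the network at a fixed time is an \<open>F\<close> with \<open>F e x\<close> the pair of values at the point
  \<open>x\<close> of the edge \<open>e\<close>; for a time-dependent \<open>R\<close>, with \<open>R e t x\<close>, this is \<open>\<lambda>e. R e t\<close>.
\<close>

definition val_in :: "('v, 'e) network \<Rightarrow> ('e \<Rightarrow> real \<Rightarrow> real \<times> real) \<Rightarrow> 'v \<Rightarrow> 'e \<Rightarrow> real" where
  "val_in N F v e = (if xend N v e = 0 then snd (F e 0) else fst (F e (len N e)))"

definition val_out :: "('v, 'e) network \<Rightarrow> ('e \<Rightarrow> real \<Rightarrow> real \<times> real) \<Rightarrow> 'v \<Rightarrow> 'e \<Rightarrow> real" where
  "val_out N F v e = (if xend N v e = 0 then fst (F e 0) else snd (F e (len N e)))"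

definition norm_in :: "('v, 'e) network \<Rightarrow> ('e \<Rightarrow> real \<Rightarrow> real \<times> real) \<Rightarrow> 'v \<Rightarrow> real" where
  "norm_in N F v = L2_set (val_in N F v) (E0 N v)"

definition norm_out :: "('v, 'e) network \<Rightarrow> ('e \<Rightarrow> real \<Rightarrow> real \<times> real) \<Rightarrow> 'v \<Rightarrow> real" where
  "norm_out N F v = L2_set (val_out N F v) (E0 N v)"

definition omega :: "('v, 'e) network \<Rightarrow> 'v \<Rightarrow> real" where
  "omega N v = 2 / (\<Sum>f\<in>E0 N v. (diam N f)\<^sup>2)"

definition K :: "('v, 'e) network \<Rightarrow> ('e \<Rightarrow> real \<Rightarrow> real \<times> real) \<Rightarrow> 'v \<Rightarrow> 'e \<Rightarrow> real" where
  "K N F v e = (if card (E0 N v) = 1 then val_in N F v e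
     else - val_in N F v e + omega N v * (\<Sum>g\<in>E0 N v. (diam N g)\<^sup>2 * val_in N F v g))"


definition node_S ::
  "('v, 'e) network \<Rightarrow> ('v \<Rightarrow> real) \<Rightarrow> ('v \<Rightarrow> real) \<Rightarrow> ('e \<Rightarrow> real \<Rightarrow> real \<times> real) \<Rightarrow> bool" where
  "node_S N \<mu> u F \<longleftrightarrow> (\<forall>v\<in>nodes N. \<forall>e\<in>E0 N v.
     val_out N F v e = (if card (E0 N v) = 1 then (1 - \<mu> v) * u v + \<mu> v * val_in N F v e
       else K N F v e))"

text \<open>In \<open>node_R\<close>, \<open>G\<close> stands for the values of \<open>S\<close> and \<open>W\<close> for those of \<open>Z\<close>.\<close>

definition node_R ::
  "('v, 'e) network \<Rightarrow> ('v \<Rightarrow> real) \<Rightarrow> ('v \<Rightarrow> real) \<Rightarrow> ('e \<Rightarrow> real \<Rightarrow> real \<times> real) \<Rightarrow>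
   ('e \<Rightarrow> real \<Rightarrow> real \<times> real) \<Rightarrow> ('e \<Rightarrow> real \<Rightarrow> real \<times> real) \<Rightarrow> bool" where
  "node_R N \<mu> u W G F \<longleftrightarrow> (\<forall>v\<in>nodes N. \<forall>e\<in>E0 N v.
     val_out N F v e =
       (if card (E0 N v) = 1 then (1 - \<mu> v) * (u v + val_out N W v e) + \<mu> v * val_in N F v e
        else \<mu> v * K N F v e + (1 - \<mu> v) * (val_out N G v e + val_out N W v e)))"

definition node_Diff ::
  "('v, 'e) network \<Rightarrow> ('v \<Rightarrow> real) \<Rightarrow> ('e \<Rightarrow> real \<Rightarrow> real \<times> real) \<Rightarrow>
   ('e \<Rightarrow> real \<Rightarrow> real \<times> real) \<Rightarrow> bool" where
  "node_Diff N \<mu> W F \<longleftrightarrow> (\<forall>v\<in>nodes N. \<forall>e\<in>E0 N v.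
     val_out N F v e = \<mu> v * K N F v e + (1 - \<mu> v) * val_out N W v e)"

definition C1_pde ::
  "('v, 'e) network \<Rightarrow> (real \<Rightarrow> real) \<Rightarrow> real \<Rightarrow> ('e \<Rightarrow> real \<Rightarrow> real \<Rightarrow> real \<times> real) \<Rightarrow> bool" where
  "C1_pde N p T S \<longleftrightarrow> (\<forall>e\<in>edges N. C1_rect T (len N e) (S e) \<and>
     (\<forall>t\<in>{0..T}. \<forall>x\<in>{0..len N e}.
        S e t x \<in> state_domain p \<and>
        fst (dt T (S e) t x) + lam_p p (S e t x) * fst (dx (len N e) (S e) t x)
          = - sigma N e (S e t x) \<and>
        snd (dt T (S e) t x) + lam_m p (S e t x) * snd (dx (len N e) (S e) t x)
          = sigma N e (S e t x)))"

definition initial_state ::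
  "('v, 'e) network \<Rightarrow> ('e \<Rightarrow> real \<Rightarrow> real \<times> real) \<Rightarrow> ('e \<Rightarrow> real \<Rightarrow> real \<Rightarrow> real \<times> real) \<Rightarrow> bool" where
  "initial_state N y S \<longleftrightarrow> (\<forall>e\<in>edges N. \<forall>x\<in>{0..len N e}. S e 0 x = y e x)"

definition classical_S ::
  "('v, 'e) network \<Rightarrow> (real \<Rightarrow> real) \<Rightarrow> ('v \<Rightarrow> real) \<Rightarrow> real \<Rightarrow> ('v \<Rightarrow> real \<Rightarrow> real) \<Rightarrow>
   ('e \<Rightarrow> real \<Rightarrow> real \<times> real) \<Rightarrow> ('e \<Rightarrow> real \<Rightarrow> real \<Rightarrow> real \<times> real) \<Rightarrow> bool" where
  "classical_S N p \<mu> T u y S \<longleftrightarrow> C1_pde N p T S \<and> initial_state N y S \<and>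
     (\<forall>t\<in>{0..T}. node_S N \<mu> (\<lambda>v. u v t) (\<lambda>e. S e t))"

definition classical_R ::
  "('v, 'e) network \<Rightarrow> (real \<Rightarrow> real) \<Rightarrow> ('v \<Rightarrow> real) \<Rightarrow> real \<Rightarrow> ('v \<Rightarrow> real \<Rightarrow> real) \<Rightarrow>
   ('e \<Rightarrow> real \<Rightarrow> real \<Rightarrow> real \<times> real) \<Rightarrow> ('e \<Rightarrow> real \<Rightarrow> real \<Rightarrow> real \<times> real) \<Rightarrow>
   ('e \<Rightarrow> real \<Rightarrow> real \<times> real) \<Rightarrow> ('e \<Rightarrow> real \<Rightarrow> real \<Rightarrow> real \<times> real) \<Rightarrow> bool" where
  "classical_R N p \<mu> T u Z S z R \<longleftrightarrow> C1_pde N p T R \<and> initial_state N z R \<and>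
     (\<forall>t\<in>{0..T}. node_R N \<mu> (\<lambda>v. u v t) (\<lambda>e. Z e t) (\<lambda>e. S e t) (\<lambda>e. R e t))"

definition classical_Diff ::
  "('v, 'e) network \<Rightarrow> (real \<Rightarrow> real) \<Rightarrow> ('v \<Rightarrow> real) \<Rightarrow> real \<Rightarrow>
   ('e \<Rightarrow> real \<Rightarrow> real \<Rightarrow> real \<times> real) \<Rightarrow> ('e \<Rightarrow> real \<Rightarrow> real \<Rightarrow> real \<times> real) \<Rightarrow>
   ('e \<Rightarrow> real \<Rightarrow> real \<times> real) \<Rightarrow> ('e \<Rightarrow> real \<Rightarrow> real \<times> real) \<Rightarrow>
   ('e \<Rightarrow> real \<Rightarrow> real \<Rightarrow> real \<times> real) \<Rightarrow> bool" where
  "classical_Diff N p \<mu> T Z S y z \<delta> \<longleftrightarrow>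
     initial_state N (\<lambda>e x. z e x - y e x) \<delta> \<and>
     (\<forall>t\<in>{0..T}. node_Diff N \<mu> (\<lambda>e. Z e t) (\<lambda>e. \<delta> e t)) \<and>
     (\<forall>e\<in>edges N. C1_rect T (len N e) (\<delta> e) \<and>
       (\<forall>t\<in>{0..T}. \<forall>x\<in>{0..len N e}.
          S e t x \<in> state_domain p \<and> S e t x + \<delta> e t x \<in> state_domain p \<and>
          fst (dt T (\<delta> e) t x)
            + lam_p p (S e t x + \<delta> e t x) * fst (dx (len N e) (\<delta> e) t x)
            + (lam_p p (S e t x + \<delta> e t x) - lam_p p (S e t x)) * fst (dx (len N e) (S e) t x)
            = - (sigma N e (S e t x + \<delta> e t x) - sigma N e (S e t x)) \<and>
          snd (dt T (\<delta> e) t x)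
            + lam_m p (S e t x + \<delta> e t x) * snd (dx (len N e) (\<delta> e) t x)
            + (lam_m p (S e t x + \<delta> e t x) - lam_m p (S e t x)) * snd (dx (len N e) (S e) t x)
            = sigma N e (S e t x + \<delta> e t x) - sigma N e (S e t x)))"

text \<open>The constant boundary data \<open>u\<close> of a steady state need not be those of the system (S).\<close>

definition steady_state_S ::
  "('v, 'e) network \<Rightarrow> (real \<Rightarrow> real) \<Rightarrow> ('v \<Rightarrow> real) \<Rightarrow> ('e \<Rightarrow> real \<Rightarrow> real \<times> real) \<Rightarrow> bool" where
  "steady_state_S N p \<mu> J \<longleftrightarrow> (\<exists>u. \<forall>T>0. classical_S N p \<mu> T (\<lambda>v t. u v) J (\<lambda>e t. J e))"


text \<open>The time derivative of the state at \<open>t = 0\<close>, expressed by the PDE in the initial state \<open>y\<close>.\<close>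

definition pde_dt ::
  "('v, 'e) network \<Rightarrow> (real \<Rightarrow> real) \<Rightarrow> ('e \<Rightarrow> real \<Rightarrow> real \<times> real) \<Rightarrow> 'e \<Rightarrow> real \<Rightarrow> real \<times> real" where
  "pde_dt N p y e x =
     (let y' = vector_derivative (y e) (at x within {0..len N e}) in
      (- sigma N e (y e x) - lam_p p (y e x) * fst y',
       sigma N e (y e x) - lam_m p (y e x) * snd y'))"

text \<open>
  The node conditions are affine with coefficients constant in time. So their time derivative is
  the same condition with every entry replaced by its time derivative.
\<close>

definition C1_compatible_S ::
  "('v, 'e) network \<Rightarrow> (real \<Rightarrow> real) \<Rightarrow> ('v \<Rightarrow> real) \<Rightarrow> real \<Rightarrow> ('v \<Rightarrow> real \<Rightarrow> real) \<Rightarrow>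
   ('e \<Rightarrow> real \<Rightarrow> real \<times> real) \<Rightarrow> bool" where
  "C1_compatible_S N p \<mu> T u y \<longleftrightarrow>
     node_S N \<mu> (\<lambda>v. u v 0) y \<and>
     node_S N \<mu> (\<lambda>v. vector_derivative (u v) (at 0 within {0..T})) (pde_dt N p y)"

definition C1_compatible_R ::
  "('v, 'e) network \<Rightarrow> (real \<Rightarrow> real) \<Rightarrow> ('v \<Rightarrow> real) \<Rightarrow> real \<Rightarrow> ('v \<Rightarrow> real \<Rightarrow> real) \<Rightarrow>
   ('e \<Rightarrow> real \<Rightarrow> real \<Rightarrow> real \<times> real) \<Rightarrow> ('e \<Rightarrow> real \<Rightarrow> real \<times> real) \<Rightarrow>
   ('e \<Rightarrow> real \<Rightarrow> real \<times> real) \<Rightarrow> bool" where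
  "C1_compatible_R N p \<mu> T u Z y z \<longleftrightarrow>
     node_R N \<mu> (\<lambda>v. u v 0) (\<lambda>e. Z e 0) y z \<and>
     node_R N \<mu> (\<lambda>v. vector_derivative (u v) (at 0 within {0..T})) (\<lambda>e. dt T (Z e) 0)
       (pde_dt N p y) (pde_dt N p z)"


definition h_p :: "('e \<Rightarrow> real) \<Rightarrow> real \<Rightarrow> 'e \<Rightarrow> real \<Rightarrow> real" where
  "h_p Bp \<psi> e x = Bp e * exp (- \<psi> * x)"

definition h_m :: "('e \<Rightarrow> real) \<Rightarrow> real \<Rightarrow> 'e \<Rightarrow> real \<Rightarrow> real" where
  "h_m Bm \<psi> e x = Bm e * exp (\<psi> * x)"

definition kappa ::
  "('v, 'e) network \<Rightarrow> ('e \<Rightarrow> real) \<Rightarrow> ('e \<Rightarrow> real) \<Rightarrow> real \<Rightarrow> 'e \<Rightarrow> real" where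
  "kappa N Bp Bm \<psi> e = (SUP x\<in>{0..len N e}.
     max (h_p Bp \<psi> e x / h_m Bm \<psi> e x) (h_m Bm \<psi> e x / h_p Bp \<psi> e x))"

text \<open>
  \<open>Min\<close> and \<open>Max\<close> of the union of the two finite families: an empty family does not contribute.
  Both are meaningful only if \<open>E0 N v \<noteq> {}\<close>.
\<close>

definition C_lower ::
  "('v, 'e) network \<Rightarrow> (real \<Rightarrow> real) \<Rightarrow> ('e \<Rightarrow> real) \<Rightarrow> ('e \<Rightarrow> real) \<Rightarrow> real \<Rightarrow>
   ('e \<Rightarrow> real \<Rightarrow> real \<Rightarrow> real \<times> real) \<Rightarrow> 'v \<Rightarrow> real \<Rightarrow> real" where
  "C_lower N p Bp Bm \<psi> R v t = Min
     ((\<lambda>e. h_p Bp \<psi> e (len N e) * lam_p p (R e t (len N e))) ` I_L N v \<union>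
      (\<lambda>e. h_m Bm \<psi> e 0 * \<bar>lam_m p (R e t 0)\<bar>) ` I_0 N v)"

definition C_upper ::
  "('v, 'e) network \<Rightarrow> (real \<Rightarrow> real) \<Rightarrow> ('e \<Rightarrow> real) \<Rightarrow> ('e \<Rightarrow> real) \<Rightarrow> real \<Rightarrow>
   ('e \<Rightarrow> real \<Rightarrow> real \<Rightarrow> real \<times> real) \<Rightarrow> 'v \<Rightarrow> real \<Rightarrow> real" where
  "C_upper N p Bp Bm \<psi> R v t = Max
     ((\<lambda>e. h_m Bm \<psi> e (len N e) * \<bar>lam_m p (R e t (len N e))\<bar>) ` I_L N v \<union>
      (\<lambda>e. h_p Bp \<psi> e 0 * lam_p p (R e t 0)) ` I_0 N v)"

definition K_bound :: "('v, 'e) network \<Rightarrow> 'v \<Rightarrow> real \<Rightarrow> bool" where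
  "K_bound N v C \<longleftrightarrow> (\<forall>F. (\<Sum>e\<in>E0 N v. \<bar>K N F v e\<bar>\<^sup>2) \<le> C * (norm_in N F v)\<^sup>2)"

definition L2_energy ::
  "('v, 'e) network \<Rightarrow> ('e \<Rightarrow> real \<Rightarrow> real \<Rightarrow> real \<times> real) \<Rightarrow> real \<Rightarrow> real" where
  "L2_energy N \<delta> t =
     (\<Sum>e\<in>edges N. integral {0..len N e} (\<lambda>x. \<bar>fst (\<delta> e t x)\<bar>\<^sup>2 + \<bar>snd (\<delta> e t x)\<bar>\<^sup>2))"

end

theory Submission
  imports Defs
begin

text \<open>
  The difference \<open>\<delta> = R - S\<close> solves (Diff) because the node conditions are affine. Its weighted
  energy \<open>V(t) = \<Sum>\<^sub>e \<integral> h\<^sub>+ \<delta>\<^sub>+\<^sup>2 + h\<^sub>- \<delta>\<^sub>-\<^sup>2 dx\<close> decays up to the perturbation: after an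
  integration by parts in the transport terms, the exponential weights yield the rate \<open>3/4 \<psi> c\<close>, and by
  the assumption on \<open>\<psi>\<close> this exceeds the losses due to the \<open>x\<close>-dependence of \<open>\<lambda>\<^sub>\<plusminus>\<close>, to
  \<open>\<lambda>\<^sub>\<plusminus>(R) - \<lambda>\<^sub>\<plusminus>(S)\<close> (of order \<open>\<beta> \<bar>\<delta>\<bar>\<close> by the mean value theorem on the convex set \<open>U\<close>) and to
  the friction. Regrouped by nodes, the boundary terms that leave the network dominate the reflected
  ones since \<open>\<mu>\<^sup>v\<close> is small, so that only a multiple of \<open>\<eta>\<close> remains. Gronwall's inequality bounds
  \<open>V\<close>, which is equivalent to the squared \<open>L\<^sup>2\<close> norm.
\<close>

section \<open>Regularity of the eigenvalues\<close>

lemma pressure_law_sqrt_deriv: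
  assumes "pressure_law p" "0 < \<rho>"
  shows "\<exists>D. ((\<lambda>r. sqrt (deriv p r)) has_real_derivative D) (at \<rho>)"
proof -
  obtain D where "(deriv p has_vector_derivative D) (at \<rho>)" and pos: "0 < deriv p \<rho>"
    using assms unfolding pressure_law_def C1_differentiable_on_def by auto
  then have "(deriv p has_real_derivative D) (at \<rho>)"
    by (simp add: has_real_derivative_iff_has_vector_derivative)
  from DERIV_chain2[OF DERIV_real_sqrt[OF pos] this] show ?thesis by blast
qed

lemma Rtilde_deriv:
  assumes "pressure_law p" "0 < \<rho>"
  shows "(Rtilde p has_real_derivative sqrt (deriv p \<rho>) / \<rho>) (at \<rho>)"
proof -
  let ?f = "\<lambda>r. sqrt (deriv p r) / r"
  \<comment> \<open>The interval from \<open>a\<close> to \<open>b\<close> consists of positive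
    densities and has both the base point 1 and \<open>\<rho>\<close> in its interior. So the
    integrand is continuous on it, and the derivative within it is the two-sided one.\<close>
  define a where "a = min 1 \<rho> / 2"
  define b where "b = max 1 \<rho> + 1"
  have ab: "0 < a" "a < 1" "1 < b" "a < \<rho>" "\<rho> < b"
    using assms(2) by (auto simp: a_def b_def)
  have "isCont (\<lambda>r. sqrt (deriv p r)) r" if "0 < r" for r
    using pressure_law_sqrt_deriv[OF assms(1) that] DERIV_isCont by blast
  then have "continuous_on {a..b} ?f"
    using ab(1) by (intro continuous_at_imp_continuous_on) (auto intro!: continuous_intros)
  from interval_integral_FTC2[OF _ _ this, of 1 \<rho>] ab
  have "((\<lambda>u. LBINT y=ereal 1..ereal u. ?f y) has_vector_derivative ?f \<rho>) (at \<rho> within {a..b})"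
    by (simp add: one_ereal_def)
  then have "(Rtilde p has_real_derivative ?f \<rho>) (at \<rho> within {a..b})"
    by (simp add: Rtilde_def[abs_def] has_real_derivative_iff_has_vector_derivative)
  moreover have "at \<rho> within {a..b} = at \<rho>"
    using ab by (intro at_within_interior) auto
  ultimately show ?thesis by simp
qed

lemma inj_on_Rtilde:
  assumes "pressure_law p"
  shows "inj_on (Rtilde p) {0<..}"
proof (rule strict_mono_on_imp_inj_on, rule strict_mono_onI)
  fix r s :: real assume rs: "r \<in> {0<..}" "s \<in> {0<..}" "r < s"
  show "Rtilde p r < Rtilde p s"
  proof (rule DERIV_pos_imp_increasing[OF rs(3)])
    fix x assume "r \<le> x" "x \<le> s"
    then have "0 < x" using rs by auto
    moreover have "0 < deriv p x" using \<open>0 < x\<close> assms unfolding pressure_law_def by auto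
    ultimately show "\<exists>y. (Rtilde p has_real_derivative y) (at x) \<and> 0 < y"
      using Rtilde_deriv[OF assms \<open>0 < x\<close>] by (intro exI[of _ "sqrt (deriv p x) / x"]) auto
  qed
qed

definition sound_speed :: "(real \<Rightarrow> real) \<Rightarrow> real \<Rightarrow> real" where
  "sound_speed p w = sqrt (deriv p (Rtilde_inv p w))"

text \<open>Inverse function theorem: the derivative of \<open>Rtilde\<close> is positive at every
  positive density, so \<open>Rtilde_inv\<close> is differentiable at each point of the image; the
  chain rule with the square root of \<open>deriv p\<close> does the rest. Outside the image
  \<open>Rtilde_inv\<close> is arbitrary, hence the assumption on \<open>w\<close>.\<close>

lemma sound_speed_differentiable:
  assumes p: "pressure_law p" and w: "w \<in> Rtilde p ` {0<..}"
  shows "\<exists>D. (sound_speed p has_real_derivative D) (at w)"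
proof -
  obtain \<rho> where \<rho>: "0 < \<rho>" and w_eq: "w = Rtilde p \<rho>" using w by auto
  have inv: "Rtilde_inv p (Rtilde p x) = x" if "x \<in> {0<..}" for x
    using inv_into_f_f[OF inj_on_Rtilde[OF p] that] by (simp add: Rtilde_inv_def)
  let ?D = "sqrt (deriv p \<rho>) / \<rho>"
  have D: "?D \<noteq> 0" using \<rho> p unfolding pressure_law_def by (metis divide_eq_0_iff less_irrefl real_sqrt_eq_0_iff)
  have "(Rtilde_inv p has_derivative (*) (inverse ?D)) (at (Rtilde p \<rho>))"
  proof (rule has_derivative_inverse_strong[of "{0<..}" \<rho> "Rtilde p"])
    show "continuous_on {0<..} (Rtilde p)"
      using Rtilde_deriv[OF p] by (intro continuous_at_imp_continuous_on ballI DERIV_isCont) auto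
    show "(Rtilde p has_derivative (*) ?D) (at \<rho>)"
      using Rtilde_deriv[OF p \<rho>] by (simp add: has_field_derivative_def)
    show "(*) ?D \<circ> (*) (inverse ?D) = id" using D by (auto simp: fun_eq_iff)
  qed (use \<rho> inv in auto)
  then have i: "(Rtilde_inv p has_real_derivative inverse ?D) (at w)"
    by (simp add: has_field_derivative_def w_eq)
  obtain E where "((\<lambda>r. sqrt (deriv p r)) has_real_derivative E) (at (Rtilde_inv p w))"
    using pressure_law_sqrt_deriv[OF p \<rho>] inv \<rho> w_eq by auto
  from DERIV_chain2[OF this i] show ?thesis by (auto simp: sound_speed_def[abs_def])
qed

section \<open>The eigenvalues as functions of the state\<close>

definition char_speed :: "(real \<Rightarrow> real) \<Rightarrow> real \<Rightarrow> real \<times> real \<Rightarrow> real" where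
  "char_speed p k r = (fst r - snd r) / 2 + k * sound_speed p ((fst r + snd r) / 2)"

text \<open>Both eigenvalues belong to one family with a sign parameter \<open>k\<close>, so every
  regularity statement is proved once for general \<open>k\<close>.\<close>

lemma lam_p_char_speed: "lam_p p = char_speed p 1"
  and lam_m_char_speed: "lam_m p = char_speed p (- 1)"
  by (auto simp: lam_p_def lam_m_def char_speed_def sound_speed_def)

text \<open>The chain rule along a curve of states, which serves three purposes: partial derivatives
  (axis-parallel curves), the mean value theorem (segments), and the space profile of
  \<open>R\<close> on an edge. The last needs derivatives within a set, because of the end points of
  the edge.\<close>

lemma char_speed_along_path:
  assumes "(sound_speed p has_real_derivative D) (at ((fst (g x) + snd (g x)) / 2))"
    and "((\<lambda>s. fst (g s)) has_real_derivative a) (at x within A)"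
    and "((\<lambda>s. snd (g s)) has_real_derivative b) (at x within A)"
  shows "((\<lambda>s. char_speed p k (g s)) has_real_derivative (1 / 2 + k * D / 2) * a + (- 1 / 2 + k * D / 2) * b)
     (at x within A)"
proof -
  have w: "((\<lambda>s. (fst (g s) + snd (g s)) / 2) has_real_derivative (a + b) / 2) (at x within A)"
    using assms(2,3) by (auto intro!: derivative_eq_intros)
  have "((\<lambda>s. sound_speed p ((fst (g s) + snd (g s)) / 2)) has_real_derivative D * ((a + b) / 2)) (at x within A)"
    by (rule DERIV_chain2[OF assms(1) w])
  with assms(2,3) show ?thesis
    unfolding char_speed_def by (auto intro!: derivative_eq_intros simp: field_simps)
qed

lemma char_speed_partial_derivs:
  assumes D: "(sound_speed p has_real_derivative D) (at ((a + b) / 2))"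
  shows "deriv (\<lambda>r. char_speed p k (r, b)) a = 1 / 2 + k * D / 2"
    and "deriv (\<lambda>r. char_speed p k (a, r)) b = - 1 / 2 + k * D / 2"
proof -
  show "deriv (\<lambda>r. char_speed p k (r, b)) a = 1 / 2 + k * D / 2"
    using char_speed_along_path[of p D "\<lambda>r. (r, b)" a 1 UNIV 0 k] D by (simp add: DERIV_imp_deriv)
  show "deriv (\<lambda>r. char_speed p k (a, r)) b = - 1 / 2 + k * D / 2"
    using char_speed_along_path[of p D "\<lambda>r. (a, r)" b 0 UNIV 1 k] D by (simp add: DERIV_imp_deriv)
qed

text \<open>Mean value theorem on the segment from \<open>s\<close> to \<open>r\<close>, which stays
  in \<open>U\<close> by convexity. The derivative along the segment is a combination of the two
  partial derivatives with the components of \<open>r - s\<close> as coefficients, and each partial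
  derivative is at most \<open>\<beta>\<close> in modulus.\<close>

lemma char_speed_lipschitz:
  assumes p: "pressure_law p" and U: "convex U" "U \<subseteq> state_domain p"
    and bound: "\<And>a b. (a, b) \<in> U \<Longrightarrow> \<bar>deriv (\<lambda>r. char_speed p k (r, b)) a\<bar> \<le> \<beta>"
      "\<And>a b. (a, b) \<in> U \<Longrightarrow> \<bar>deriv (\<lambda>r. char_speed p k (a, r)) b\<bar> \<le> \<beta>"
    and rs: "r \<in> U" "s \<in> U"
  shows "\<bar>char_speed p k r - char_speed p k s\<bar> \<le> \<beta> * (\<bar>fst r - fst s\<bar> + \<bar>snd r - snd s\<bar>)"
proof -
  define g where "g = (\<lambda>\<tau>. s + \<tau> *\<^sub>R (r - s))"
  have g_in: "g \<tau> \<in> U" if "0 \<le> \<tau>" "\<tau> \<le> 1" for \<tau>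
  proof -
    have "g \<tau> = (1 - \<tau>) *\<^sub>R s + \<tau> *\<^sub>R r" by (simp add: g_def algebra_simps)
    then show ?thesis using convexD[OF U(1) rs(2,1), of "1 - \<tau>" \<tau>] that by auto
  qed
  have "\<exists>c. ((\<lambda>\<tau>. char_speed p k (g \<tau>)) has_real_derivative c) (at \<tau>)
      \<and> \<bar>c\<bar> \<le> \<beta> * (\<bar>fst r - fst s\<bar> + \<bar>snd r - snd s\<bar>)" if \<tau>: "0 \<le> \<tau>" "\<tau> \<le> 1" for \<tau>
  proof -
    let ?a = "fst (g \<tau>)" and ?b = "snd (g \<tau>)"
    have in_U: "(?a, ?b) \<in> U" using g_in[OF \<tau>] by simp
    then have "(?a + ?b) / 2 \<in> Rtilde p ` {0<..}" using U(2) by (auto simp: state_domain_def)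
    then obtain D where D: "(sound_speed p has_real_derivative D) (at ((?a + ?b) / 2))"
      using sound_speed_differentiable[OF p] by blast
    let ?c1 = "1 / 2 + k * D / 2" and ?c2 = "- 1 / 2 + k * D / 2"
    have c: "\<bar>?c1\<bar> \<le> \<beta>" "\<bar>?c2\<bar> \<le> \<beta>"
      using bound[OF in_U] unfolding char_speed_partial_derivs[OF D] by auto
    have "((\<lambda>\<tau>. char_speed p k (g \<tau>)) has_real_derivative
        ?c1 * (fst r - fst s) + ?c2 * (snd r - snd s)) (at \<tau>)"
      by (rule char_speed_along_path[where g = g, OF D]) (auto simp: g_def intro!: derivative_eq_intros)
    moreover have "\<bar>?c1 * (fst r - fst s) + ?c2 * (snd r - snd s)\<bar>
        \<le> \<bar>?c1\<bar> * \<bar>fst r - fst s\<bar> + \<bar>?c2\<bar> * \<bar>snd r - snd s\<bar>"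
      using abs_triangle_ineq by (metis abs_mult)
    moreover have "\<dots> \<le> \<beta> * \<bar>fst r - fst s\<bar> + \<beta> * \<bar>snd r - snd s\<bar>"
      using c by (intro add_mono mult_right_mono) auto
    ultimately show ?thesis by (auto simp: distrib_left)
  qed
  then obtain c where c: "\<And>\<tau>. 0 \<le> \<tau> \<Longrightarrow> \<tau> \<le> 1 \<Longrightarrow>
      ((\<lambda>\<tau>. char_speed p k (g \<tau>)) has_real_derivative c \<tau>) (at \<tau>)
      \<and> \<bar>c \<tau>\<bar> \<le> \<beta> * (\<bar>fst r - fst s\<bar> + \<bar>snd r - snd s\<bar>)"
    by metis
  obtain \<tau> where "0 < \<tau>" "\<tau> < 1" "char_speed p k (g 1) - char_speed p k (g 0) = (1 - 0) * c \<tau>"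
    using MVT2[of 0 1 "\<lambda>\<tau>. char_speed p k (g \<tau>)" c] c by auto
  with c[of \<tau>] show ?thesis by (auto simp: g_def)
qed

section \<open>Calculus on the space-time rectangle\<close>

text \<open>Derivatives within a nondegenerate closed interval are unique, also at its ends. Hence
  \<open>dt\<close> and \<open>dx\<close> agree on the rectangle with whatever continuous
  derivatives \<open>C1_rect\<close> provides.\<close>

lemma C1_rect_vd:
  fixes F :: "real \<Rightarrow> real \<Rightarrow> 'a::euclidean_space"
  assumes F: "C1_rect T l F" and pos: "0 < T" "0 < l"
  shows "t \<in> {0..T} \<Longrightarrow> x \<in> {0..l} \<Longrightarrow>
      ((\<lambda>s. F s x) has_vector_derivative dt T F t x) (at t within {0..T})"
    and "t \<in> {0..T} \<Longrightarrow> x \<in> {0..l} \<Longrightarrow>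
      ((\<lambda>y. F t y) has_vector_derivative dx l F t x) (at x within {0..l})"
    and "continuous_on ({0..T} \<times> {0..l}) (\<lambda>(t, x). dt T F t x)"
    and "continuous_on ({0..T} \<times> {0..l}) (\<lambda>(t, x). dx l F t x)"
proof -
  obtain Ft Fx where c: "continuous_on ({0..T} \<times> {0..l}) (\<lambda>(t, x). Ft t x)"
      "continuous_on ({0..T} \<times> {0..l}) (\<lambda>(t, x). Fx t x)"
    and vd: "\<And>t x. t \<in> {0..T} \<Longrightarrow> x \<in> {0..l} \<Longrightarrow>
        ((\<lambda>s. F s x) has_vector_derivative Ft t x) (at t within {0..T})"
      "\<And>t x. t \<in> {0..T} \<Longrightarrow> x \<in> {0..l} \<Longrightarrow>
        ((\<lambda>y. F t y) has_vector_derivative Fx t x) (at x within {0..l})"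
    using F unfolding C1_rect_def by blast
  have eq: "dt T F t x = Ft t x" "dx l F t x = Fx t x" if "t \<in> {0..T}" "x \<in> {0..l}" for t x
    unfolding dt_def dx_def
    using vector_derivative_within_closed_interval[OF pos(1) that(1) vd(1)[OF that]]
      vector_derivative_within_closed_interval[OF pos(2) that(2) vd(2)[OF that]] by auto
  show "t \<in> {0..T} \<Longrightarrow> x \<in> {0..l} \<Longrightarrow>
      ((\<lambda>s. F s x) has_vector_derivative dt T F t x) (at t within {0..T})"
    "t \<in> {0..T} \<Longrightarrow> x \<in> {0..l} \<Longrightarrow>
      ((\<lambda>y. F t y) has_vector_derivative dx l F t x) (at x within {0..l})"
    using vd eq by auto
  show "continuous_on ({0..T} \<times> {0..l}) (\<lambda>(t, x). dt T F t x)"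
    by (rule continuous_on_eq[OF c(1)]) (auto simp: eq)
  show "continuous_on ({0..T} \<times> {0..l}) (\<lambda>(t, x). dx l F t x)"
    by (rule continuous_on_eq[OF c(2)]) (auto simp: eq)
qed

text \<open>\<open>C1_rect\<close> asks for continuous partial derivatives but does not mention
  joint continuity of \<open>F\<close>. It follows from total differentiability: a partial
  derivative in t at the point together with a continuous partial derivative in x suffices for that.
  The latter has to be continuous as a linear map, which is why \<open>dx\<close> is wrapped into
  \<open>blinfun_scaleR_left\<close>.\<close>

lemma C1_rect_continuous:
  fixes F :: "real \<Rightarrow> real \<Rightarrow> 'a::euclidean_space"
  assumes F: "C1_rect T l F" and pos: "0 < T" "0 < l"
  shows "continuous_on ({0..T} \<times> {0..l}) (\<lambda>(t, x). F t x)"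
  unfolding continuous_on_eq_continuous_within
proof safe
  fix t x assume tx: "t \<in> {0..T}" "x \<in> {0..l}"
  note vd = C1_rect_vd[OF F pos]
  have "((\<lambda>(t, x). F t x) has_derivative
      (\<lambda>(tt, tx). tt *\<^sub>R dt T F t x + blinfun_apply (blinfun_scaleR_left (dx l F t x)) tx))
      (at (t, x) within {0..T} \<times> {0..l})"
  proof (rule has_derivative_partialsI[where fx = "\<lambda>h. h *\<^sub>R dt T F t x"
        and fy = "\<lambda>t x. blinfun_scaleR_left (dx l F t x)"])
    show "((\<lambda>s. F s x) has_derivative (\<lambda>h. h *\<^sub>R dt T F t x)) (at t within {0..T})"
      using vd(1)[OF tx] by (simp add: has_vector_derivative_def)
    show "((\<lambda>y. F t y) has_derivative blinfun_apply (blinfun_scaleR_left (dx l F t x))) (at x within {0..l})"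
      if "t \<in> {0..T}" "x \<in> {0..l}" for t x
      using vd(2)[OF that] by (simp add: has_vector_derivative_def)
    have "continuous (at (t, x) within {0..T} \<times> {0..l}) (\<lambda>(t, x). dx l F t x)"
      using vd(4) tx by (auto simp: continuous_on_eq_continuous_within)
    then have "((\<lambda>(t, x). dx l F t x) \<longlongrightarrow> dx l F t x) (at (t, x) within {0..T} \<times> {0..l})"
      by (simp add: continuous_within)
    then show "continuous (at (t, x) within {0..T} \<times> {0..l}) (\<lambda>(t, x). blinfun_scaleR_left (dx l F t x))"
      unfolding split_beta continuous_within fst_conv snd_conv
      by (rule bounded_linear.tendsto[OF bounded_linear_blinfun_scaleR_left])
  qed (use tx in auto)
  then show "continuous (at (t, x) within {0..T} \<times> {0..l}) (\<lambda>(t, x). F t x)"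
    by (rule has_derivative_continuous)
qed

section \<open>Linear images and differences of functions on the rectangle\<close>

lemma C1_rect_bounded_linear:
  assumes "C1_rect T l F" and h: "bounded_linear h"
  shows "C1_rect T l (\<lambda>t x. h (F t x))"
proof -
  obtain Ft Fx where c: "continuous_on ({0..T} \<times> {0..l}) (\<lambda>(t, x). Ft t x)"
      "continuous_on ({0..T} \<times> {0..l}) (\<lambda>(t, x). Fx t x)"
    and vd: "\<forall>t\<in>{0..T}. \<forall>x\<in>{0..l}.
        ((\<lambda>s. F s x) has_vector_derivative Ft t x) (at t within {0..T}) \<and>
        ((\<lambda>y. F t y) has_vector_derivative Fx t x) (at x within {0..l})"
    using assms(1) unfolding C1_rect_def by blast
  show ?thesis unfolding C1_rect_def
  proof (intro exI conjI)
    show "continuous_on ({0..T} \<times> {0..l}) (\<lambda>(t, x). h (Ft t x))"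
      "continuous_on ({0..T} \<times> {0..l}) (\<lambda>(t, x). h (Fx t x))"
      using bounded_linear.continuous_on[OF h c(1)] bounded_linear.continuous_on[OF h c(2)]
      by (simp_all add: split_beta)
    show "\<forall>t\<in>{0..T}. \<forall>x\<in>{0..l}.
        ((\<lambda>s. h (F s x)) has_vector_derivative h (Ft t x)) (at t within {0..T}) \<and>
        ((\<lambda>y. h (F t y)) has_vector_derivative h (Fx t x)) (at x within {0..l})"
      using vd bounded_linear.has_vector_derivative[OF h] by blast
  qed
qed

lemma C1_rect_diff:
  assumes "C1_rect T l F" "C1_rect T l G"
  shows "C1_rect T l (\<lambda>t x. F t x - G t x)"
proof -
  obtain Ft Fx where c: "continuous_on ({0..T} \<times> {0..l}) (\<lambda>(t, x). Ft t x)"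
      "continuous_on ({0..T} \<times> {0..l}) (\<lambda>(t, x). Fx t x)"
    and vd: "\<forall>t\<in>{0..T}. \<forall>x\<in>{0..l}.
        ((\<lambda>s. F s x) has_vector_derivative Ft t x) (at t within {0..T}) \<and>
        ((\<lambda>y. F t y) has_vector_derivative Fx t x) (at x within {0..l})"
    using assms(1) unfolding C1_rect_def by blast
  obtain Gt Gx where c': "continuous_on ({0..T} \<times> {0..l}) (\<lambda>(t, x). Gt t x)"
      "continuous_on ({0..T} \<times> {0..l}) (\<lambda>(t, x). Gx t x)"
    and vd': "\<forall>t\<in>{0..T}. \<forall>x\<in>{0..l}.
        ((\<lambda>s. G s x) has_vector_derivative Gt t x) (at t within {0..T}) \<and>
        ((\<lambda>y. G t y) has_vector_derivative Gx t x) (at x within {0..l})"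
    using assms(2) unfolding C1_rect_def by blast
  show ?thesis unfolding C1_rect_def
  proof (intro exI conjI)
    show "continuous_on ({0..T} \<times> {0..l}) (\<lambda>(t, x). Ft t x - Gt t x)"
      "continuous_on ({0..T} \<times> {0..l}) (\<lambda>(t, x). Fx t x - Gx t x)"
      using continuous_on_diff[OF c(1) c'(1)] continuous_on_diff[OF c(2) c'(2)]
      by (simp_all add: split_beta)
    show "\<forall>t\<in>{0..T}. \<forall>x\<in>{0..l}.
        ((\<lambda>s. F s x - G s x) has_vector_derivative Ft t x - Gt t x) (at t within {0..T}) \<and>
        ((\<lambda>y. F t y - G t y) has_vector_derivative Fx t x - Gx t x) (at x within {0..l})"
      using vd vd' has_vector_derivative_diff by blast
  qed
qed

text \<open>With \<open>fst\<close> and \<open>snd\<close> for \<open>h\<close> this mediates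
  between the PDE, which takes components of the derivative of a pair, and the bounds by
  \<open>Mhat\<close>, which concern derivatives of the components.\<close>

lemma dt_dx_bounded_linear:
  fixes F :: "real \<Rightarrow> real \<Rightarrow> 'a::euclidean_space" and h :: "'a \<Rightarrow> 'b::euclidean_space"
  assumes F: "C1_rect T l F" and h: "bounded_linear h" and pos: "0 < T" "0 < l"
    and tx: "t \<in> {0..T}" "x \<in> {0..l}"
  shows "dt T (\<lambda>t x. h (F t x)) t x = h (dt T F t x)"
    and "dx l (\<lambda>t x. h (F t x)) t x = h (dx l F t x)"
  using bounded_linear.has_vector_derivative[OF h C1_rect_vd(1)[OF F pos tx]]
    bounded_linear.has_vector_derivative[OF h C1_rect_vd(2)[OF F pos tx]] pos tx
  by (simp_all add: dt_def[of T "\<lambda>t x. h (F t x)"] dx_def[of l "\<lambda>t x. h (F t x)"]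
      vector_derivative_within_closed_interval)

lemma dt_dx_diff:
  fixes F G :: "real \<Rightarrow> real \<Rightarrow> 'a::euclidean_space"
  assumes F: "C1_rect T l F" and G: "C1_rect T l G" and pos: "0 < T" "0 < l"
    and tx: "t \<in> {0..T}" "x \<in> {0..l}"
  shows "dt T (\<lambda>t x. F t x - G t x) t x = dt T F t x - dt T G t x"
    and "dx l (\<lambda>t x. F t x - G t x) t x = dx l F t x - dx l G t x"
  using has_vector_derivative_diff[OF C1_rect_vd(1)[OF F pos tx] C1_rect_vd(1)[OF G pos tx]]
    has_vector_derivative_diff[OF C1_rect_vd(2)[OF F pos tx] C1_rect_vd(2)[OF G pos tx]] pos tx
  by (simp_all add: dt_def[of T "\<lambda>t x. F t x - G t x"] dx_def[of l "\<lambda>t x. F t x - G t x"]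
      vector_derivative_within_closed_interval)

text \<open>A real supremum is an upper bound only if the set is bounded above; here this holds
  because the maximum is continuous on a compact rectangle.\<close>

lemma C1_norm_abs_le:
  assumes f: "C1_rect T l f" and pos: "0 < T" "0 < l"
    and tx: "t \<in> {0..T}" "x \<in> {0..l}"
  shows "\<bar>f t x\<bar> \<le> C1_norm T l f"
proof -
  let ?Q = "{0..T} \<times> {0..l}"
  let ?m = "\<lambda>(t, x). max \<bar>f t x\<bar> (max \<bar>dt T f t x\<bar> \<bar>dx l f t x\<bar>)"
  have "continuous_on ?Q ?m"
    using C1_rect_continuous[OF f pos] C1_rect_vd(3,4)[OF f pos]
    unfolding split_beta by (intro continuous_intros)
  then have "bdd_above (?m ` ?Q)"
    by (intro bounded_imp_bdd_above compact_imp_bounded compact_continuous_image compact_Times) auto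
  then have "?m (t, x) \<le> C1_norm T l f"
    unfolding C1_norm_def using tx by (intro cSUP_upper) auto
  then show ?thesis by auto
qed

section \<open>Energy inequalities\<close>

lemma gronwall_exponential_decay:
  fixes L :: "real \<Rightarrow> real"
  assumes deriv: "\<And>t. t \<in> {0..T} \<Longrightarrow> (L has_real_derivative L' t) (at t within {0..T})"
    and le: "\<And>t. t \<in> {0..T} \<Longrightarrow> L' t \<le> - \<gamma> * L t + b"
    and \<gamma>: "0 < \<gamma>" and b: "0 \<le> b" and t: "t \<in> {0..T}"
  shows "L t \<le> exp (- \<gamma> * t) * L 0 + b / \<gamma>"
proof -
  \<comment> \<open>Integrating factor: \<open>b / \<gamma>\<close> is the equilibrium of the
    comparison equation, and the distance of \<open>L\<close> to it, multiplied by the exponential,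
    is nonincreasing.\<close>
  define G where "G s = exp (\<gamma> * s) * (L s - b / \<gamma>)" for s
  have G': "(G has_real_derivative exp (\<gamma> * s) * (L' s + \<gamma> * L s - b)) (at s within {0..T})"
    if "s \<in> {0..T}" for s
    unfolding G_def using deriv[OF that] \<gamma>
    by (auto intro!: derivative_eq_intros simp: field_simps)
  have "G t \<le> G 0"
  proof (rule DERIV_nonpos_imp_decreasing_open[where f = G])
    show "0 \<le> t" using t by simp
    show "continuous_on {0..t} G"
      by (rule continuous_on_subset[OF DERIV_continuous_on[OF G']]) (use t in auto)
    fix s assume s: "0 < s" "s < t"
    \<comment> \<open>The monotonicity criterion wants two-sided derivatives, but only at interior
      points.\<close>
    then have "at s within {0..T} = at s" using t by (intro at_within_interior) auto
    moreover have "exp (\<gamma> * s) * (L' s + \<gamma> * L s - b) \<le> 0"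
      using le[of s] s t by (intro mult_nonneg_nonpos) auto
    ultimately show "\<exists>y. (G has_real_derivative y) (at s) \<and> y \<le> 0"
      using G'[of s] s t by auto
  qed
  then have "exp (- \<gamma> * t) * (exp (\<gamma> * t) * (L t - b / \<gamma>)) \<le> exp (- \<gamma> * t) * (L 0 - b / \<gamma>)"
    unfolding G_def by (intro mult_left_mono) auto
  then have "L t - b / \<gamma> \<le> exp (- \<gamma> * t) * (L 0 - b / \<gamma>)"
    by (simp add: mult.assoc[symmetric] exp_add[symmetric])
  moreover have "0 \<le> exp (- \<gamma> * t) * (b / \<gamma>)" using b \<gamma> by simp
  ultimately show ?thesis by (simp add: right_diff_distrib)
qed

section \<open>Pointwise and nodal estimates\<close>

lemma abs_mult_self_slope:
  fixes x y :: real
  shows "\<exists>m. 0 \<le> m \<and> m \<le> \<bar>x\<bar> + \<bar>y\<bar> \<and> \<bar>x\<bar> * x - \<bar>y\<bar> * y = m * (x - y)"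
proof (cases "0 \<le> x \<longleftrightarrow> 0 \<le> y")
  case True
  \<comment> \<open>For equal signs the difference is plus or minus
    \<open>x\<^sup>2 - y\<^sup>2\<close>, so the secant slope is the sum of the moduli.\<close>
  then show ?thesis by (intro exI[of _ "\<bar>x\<bar> + \<bar>y\<bar>"]) (auto simp: algebra_simps abs_if)
next
  case False
  \<comment> \<open>For opposite signs the difference is plus or minus the sum of the squares, while
    the distance of \<open>x\<close> and \<open>y\<close> is the sum of the moduli.\<close>
  then have pos: "0 < \<bar>x\<bar> + \<bar>y\<bar>" and d: "\<bar>x - y\<bar> = \<bar>x\<bar> + \<bar>y\<bar>" by auto
  have "x\<^sup>2 + y\<^sup>2 \<le> (\<bar>x\<bar> + \<bar>y\<bar>) * (\<bar>x\<bar> + \<bar>y\<bar>)" by (simp add: power2_eq_square algebra_simps)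
  then have "(x\<^sup>2 + y\<^sup>2) / (\<bar>x\<bar> + \<bar>y\<bar>) \<le> \<bar>x\<bar> + \<bar>y\<bar>" using pos by (simp add: pos_divide_le_eq)
  moreover have "\<bar>x\<bar> * x - \<bar>y\<bar> * y = (x\<^sup>2 + y\<^sup>2) / (\<bar>x\<bar> + \<bar>y\<bar>) * (x - y)"
    using False pos by (auto simp: field_simps power2_eq_square abs_if split: if_splits)
  ultimately show ?thesis using pos by (intro exI[of _ "(x\<^sup>2 + y\<^sup>2) / (\<bar>x\<bar> + \<bar>y\<bar>)"]) auto
qed

text \<open>Young's inequality needs the weight \<open>g\<close> on one factor and \<open>h\<close>
  on the other. Exchanging one \<open>g\<close> for \<open>\<kappa> * h\<close> after squaring makes
  it applicable.\<close>

lemma weighted_cross_term_le: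
  fixes g h a b \<kappa> :: real
  assumes "0 < g" "0 < h" "g \<le> \<kappa> * h" "1 \<le> \<kappa>"
  shows "g * (\<bar>a\<bar> * \<bar>b\<bar>) \<le> \<kappa> * (g * a\<^sup>2 + h * b\<^sup>2) / 2"
proof (rule power2_le_imp_le)
  have "(g * (\<bar>a\<bar> * \<bar>b\<bar>))\<^sup>2 = g * (g * (a\<^sup>2 * b\<^sup>2))"
    by (simp add: power_mult_distrib) (simp add: power2_eq_square)
  also have "\<dots> \<le> \<kappa> * h * (g * (a\<^sup>2 * b\<^sup>2))"
    using assms by (intro mult_right_mono) auto
  also have "\<dots> = \<kappa> * ((g * a\<^sup>2) * (h * b\<^sup>2))" by (simp add: algebra_simps)
  also have "\<dots> \<le> \<kappa>\<^sup>2 * ((g * a\<^sup>2 + h * b\<^sup>2)\<^sup>2 / 4)"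
  proof (rule mult_mono)
    \<comment> \<open>Enlarging \<open>\<kappa>\<close> to its square makes the bound a perfect
      square; this is where \<open>1 \<le> \<kappa>\<close> enters.\<close>
    show "\<kappa> \<le> \<kappa>\<^sup>2" using assms(4) by (simp add: power2_eq_square)
    have "0 \<le> (g * a\<^sup>2 - h * b\<^sup>2)\<^sup>2" by simp
    then show "(g * a\<^sup>2) * (h * b\<^sup>2) \<le> (g * a\<^sup>2 + h * b\<^sup>2)\<^sup>2 / 4"
      by (simp add: power2_eq_square algebra_simps)
  qed (use assms in auto)
  finally show "(g * (\<bar>a\<bar> * \<bar>b\<bar>))\<^sup>2 \<le> (\<kappa> * (g * a\<^sup>2 + h * b\<^sup>2) / 2)\<^sup>2"
    by (simp add: power_mult_distrib power_divide)
qed (use assms in auto)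

text \<open>Meant for the coupling through the change of the eigenvalues: \<open>P\<close> stands
  for the difference of an eigenvalue at \<open>R\<close> and at \<open>S\<close>, \<open>q\<close>
  for the x-derivative of the component of \<open>S\<close>, and \<open>w\<close> for a
  weight.\<close>

lemma source_term_le:
  fixes w :: real
  assumes "\<bar>P\<bar> \<le> \<beta> * (\<bar>a\<bar> + \<bar>b\<bar>)" "\<bar>q\<bar> \<le> m" "0 \<le> w" "0 \<le> \<beta>"
  shows "- (2 * w * a * (P * q)) \<le> 2 * (\<beta> * m) * (w * a\<^sup>2 + w * (\<bar>a\<bar> * \<bar>b\<bar>))"
proof -
  have "\<bar>P\<bar> * \<bar>q\<bar> \<le> \<beta> * (\<bar>a\<bar> + \<bar>b\<bar>) * m" using assms by (intro mult_mono) auto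
  then have "(2 * w * \<bar>a\<bar>) * (\<bar>P\<bar> * \<bar>q\<bar>) \<le> (2 * w * \<bar>a\<bar>) * (\<beta> * (\<bar>a\<bar> + \<bar>b\<bar>) * m)"
    using assms by (intro mult_left_mono) auto
  moreover have "- (2 * w * a * (P * q)) \<le> \<bar>2 * w * a * (P * q)\<bar>" by linarith
  moreover have "\<bar>2 * w * a * (P * q)\<bar> = (2 * w * \<bar>a\<bar>) * (\<bar>P\<bar> * \<bar>q\<bar>)" using assms by (simp add: abs_mult)
  moreover have "(2 * w * \<bar>a\<bar>) * (\<beta> * (\<bar>a\<bar> + \<bar>b\<bar>) * m) = 2 * (\<beta> * m) * (w * a\<^sup>2 + w * (\<bar>a\<bar> * \<bar>b\<bar>))"
    by (simp add: power2_eq_square algebra_simps)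
  ultimately show ?thesis by linarith
qed

text \<open>
  The friction term enters as \<open>s (a - b)\<close> with \<open>0 \<le> s\<close>: the diagonal part of its contribution
  dissipates, so only the cross term costs a factor \<open>\<kappa>\<close>.
\<close>

lemma dissipation_pointwise:
  fixes g h :: real
  assumes w: "0 < g" "0 < h" "g \<le> \<kappa> * h" "h \<le> \<kappa> * g" "1 \<le> \<kappa>"
    and s: "0 \<le> s" "s \<le> sb"
    and P: "\<bar>P\<bar> \<le> \<beta> * (\<bar>a\<bar> + \<bar>b\<bar>)" "\<bar>Q\<bar> \<le> \<beta> * (\<bar>a\<bar> + \<bar>b\<bar>)" "0 \<le> \<beta>"
    and q: "\<bar>qp\<bar> \<le> m" "\<bar>qm\<bar> \<le> m"
    and l: "3/4 * c \<le> lp" "lm \<le> - (3/4) * c" "\<bar>lp'\<bar> \<le> \<epsilon>" "\<bar>lm'\<bar> \<le> \<epsilon>" "0 \<le> \<psi>"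
    and pde: "da = - lp * ax - P * qp - s * (a - b)" "db = - lm * bx - Q * qm + s * (a - b)"
  shows "2 * g * a * da + 2 * h * b * db
      \<le> - (g * ((lp' - \<psi> * lp) * a\<^sup>2 + 2 * lp * a * ax)) - h * ((lm' + \<psi> * lm) * b\<^sup>2 + 2 * lm * b * bx)
        - (3/4 * \<psi> * c - \<epsilon> - (2 * sb + 4 * \<beta> * m) * \<kappa>) * (g * a\<^sup>2 + h * b\<^sup>2)"
proof -
  \<comment> \<open>\<open>W\<close> is the weighted energy density; \<open>X\<close> collects the
    mixed products with both weights, each of which costs half of
    \<open>\<kappa> * W\<close>.\<close>
  define W where "W = g * a\<^sup>2 + h * b\<^sup>2"
  define X where "X = (g + h) * (\<bar>a\<bar> * \<bar>b\<bar>)"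
  have W: "0 \<le> W" using w by (simp add: W_def)
  have m: "0 \<le> m" using q by linarith
  have X: "X \<le> \<kappa> * W"
    using weighted_cross_term_le[OF w(1,2,3,5), of a b] weighted_cross_term_le[OF w(2,1,4,5), of b a]
    by (simp add: X_def W_def algebra_simps)
  have W_le: "W \<le> \<kappa> * W" using mult_right_mono[OF w(5) W] by simp
  \<comment> \<open>The weights contribute \<open>- \<psi> * lp\<close> and
    \<open>\<psi> * lm\<close>. Since \<open>lm\<close> is negative and its weight grows with x,
    both components gain the same rate \<open>3/4 * \<psi> * c\<close>.\<close>
  have "\<psi> * (3/4 * c) \<le> \<psi> * lp" using l by (intro mult_left_mono) auto
  then have t1: "g * ((lp' - \<psi> * lp) * a\<^sup>2) \<le> g * ((\<epsilon> - 3/4 * \<psi> * c) * a\<^sup>2)"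
    using l w by (intro mult_left_mono mult_right_mono) auto
  have "\<psi> * lm \<le> \<psi> * (- (3/4) * c)" using l by (intro mult_left_mono) auto
  then have t2: "h * ((lm' + \<psi> * lm) * b\<^sup>2) \<le> h * ((\<epsilon> - 3/4 * \<psi> * c) * b\<^sup>2)"
    using l w by (intro mult_left_mono mult_right_mono) auto
  have t3: "- (2 * g * a * (P * qp)) \<le> 2 * (\<beta> * m) * (g * a\<^sup>2 + g * (\<bar>a\<bar> * \<bar>b\<bar>))"
    using P q w by (intro source_term_le) auto
  have t4: "- (2 * h * b * (Q * qm)) \<le> 2 * (\<beta> * m) * (h * b\<^sup>2 + h * (\<bar>b\<bar> * \<bar>a\<bar>))"
    using P q w by (intro source_term_le) (auto simp: add.commute)
  \<comment> \<open>The diagonal and the mixed parts are each at most \<open>\<kappa> * W\<close>;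
    this gives the constant 4 in front of \<open>\<beta> * m\<close>.\<close>
  have "2 * (\<beta> * m) * (W + X) \<le> 2 * (\<beta> * m) * (2 * \<kappa> * W)"
    using X W_le P m by (intro mult_left_mono) auto
  then have t34: "- (2 * g * a * (P * qp)) - 2 * h * b * (Q * qm) \<le> 4 * (\<beta> * m) * (\<kappa> * W)"
    using t3 t4 by (simp add: W_def X_def algebra_simps)
  have "a * b \<le> \<bar>a\<bar> * \<bar>b\<bar>" by (simp add: abs_mult[symmetric])
  then have "(g + h) * (a * b) \<le> X" using w by (simp add: X_def mult_left_mono)
  \<comment> \<open>Expanding the friction contribution leaves the mixed products minus
    \<open>W\<close>; the term with \<open>W\<close> has the favourable sign and is dropped.\<close>
  then have "(g + h) * (a * b) - W \<le> \<kappa> * W" using X W by linarith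
  then have "2 * s * ((g + h) * (a * b) - W) \<le> 2 * s * (\<kappa> * W)"
    using s by (intro mult_left_mono) auto
  also have "\<dots> \<le> 2 * sb * (\<kappa> * W)"
    using s W W_le by (intro mult_right_mono) auto
  finally have t5: "- (2 * (s * (a - b)) * (g * a - h * b)) \<le> 2 * sb * (\<kappa> * W)"
    by (simp add: W_def power2_eq_square algebra_simps)
  \<comment> \<open>Moving the derivative of the flux to the left cancels all terms with
    \<open>ax\<close> and \<open>bx\<close>, so only the four estimated groups remain.\<close>
  have "2 * g * a * da + 2 * h * b * db
      + g * ((lp' - \<psi> * lp) * a\<^sup>2 + 2 * lp * a * ax) + h * ((lm' + \<psi> * lm) * b\<^sup>2 + 2 * lm * b * bx)
    = g * ((lp' - \<psi> * lp) * a\<^sup>2) + h * ((lm' + \<psi> * lm) * b\<^sup>2)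
      + (- (2 * g * a * (P * qp)) - 2 * h * b * (Q * qm)) + - (2 * (s * (a - b)) * (g * a - h * b))"
    unfolding pde by (simp add: algebra_simps)
  also have "\<dots> \<le> g * ((\<epsilon> - 3/4 * \<psi> * c) * a\<^sup>2) + h * ((\<epsilon> - 3/4 * \<psi> * c) * b\<^sup>2)
      + 4 * (\<beta> * m) * (\<kappa> * W) + 2 * sb * (\<kappa> * W)"
    using t1 t2 t34 t5 by (intro add_mono)
  also have "\<dots> = - (3/4 * \<psi> * c - \<epsilon> - (2 * sb + 4 * \<beta> * m) * \<kappa>) * W"
    by (simp add: W_def algebra_simps)
  finally show ?thesis unfolding W_def by linarith
qed

text \<open>The square of an outgoing value is at most twice the reflected square plus twice the
  square of the perturbation; this is the 2 in the smallness condition on \<open>\<mu>\<close>. The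
  reflected part is absorbed by the incoming squares via \<open>Ch\<close>. Two bounds on the
  outgoing weights are kept: \<open>Cu\<close> is the one in the smallness condition and may vary in
  time, whereas \<open>Co\<close> multiplies the perturbation and can be chosen uniformly.\<close>

lemma node_dissipation:
  fixes Co :: real
  assumes E: "finite E" and bc: "\<And>e. e \<in> E \<Longrightarrow> o' e = \<mu> * k e + (1 - \<mu>) * z e"
    and \<mu>: "0 \<le> \<mu>" "\<mu> \<le> 1"
    and wo: "\<And>e. e \<in> E \<Longrightarrow> 0 \<le> wo e" "\<And>e. e \<in> E \<Longrightarrow> wo e \<le> Cu" "\<And>e. e \<in> E \<Longrightarrow> wo e \<le> Co"
    and wi: "\<And>e. e \<in> E \<Longrightarrow> Cl \<le> wi e"
    and k: "(\<Sum>e\<in>E. (k e)\<^sup>2) \<le> Ch * (\<Sum>e\<in>E. (i e)\<^sup>2)"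
    and Cu: "0 \<le> Cu" "0 \<le> Cl - 2 * Cu * Ch * \<mu>\<^sup>2"
  shows "(\<Sum>e\<in>E. wo e * (o' e)\<^sup>2 - wi e * (i e)\<^sup>2) \<le> Co * (2 * (\<Sum>e\<in>E. (z e)\<^sup>2))"
proof -
  have "wo e * (o' e)\<^sup>2 - wi e * (i e)\<^sup>2
      \<le> 2 * Cu * \<mu>\<^sup>2 * (k e)\<^sup>2 + 2 * Co * (z e)\<^sup>2 - Cl * (i e)\<^sup>2" if e: "e \<in> E" for e
  proof -
    have "(o' e)\<^sup>2 \<le> 2 * (\<mu> * k e)\<^sup>2 + 2 * ((1 - \<mu>) * z e)\<^sup>2"
      using sum_squares_bound[of "\<mu> * k e" "(1 - \<mu>) * z e"] unfolding bc[OF e] by (simp add: power2_sum)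
    moreover have "((1 - \<mu>) * z e)\<^sup>2 \<le> (z e)\<^sup>2"
      using \<mu> unfolding power_mult_distrib by (intro mult_left_le_one_le) (auto simp: power_le_one)
    ultimately have "(o' e)\<^sup>2 \<le> 2 * \<mu>\<^sup>2 * (k e)\<^sup>2 + 2 * (z e)\<^sup>2" by (simp add: power_mult_distrib)
    then have "wo e * (o' e)\<^sup>2 \<le> wo e * (2 * \<mu>\<^sup>2 * (k e)\<^sup>2) + wo e * (2 * (z e)\<^sup>2)"
      using mult_left_mono[OF _ wo(1)[OF e]] unfolding distrib_left[symmetric] by blast
    also have "\<dots> \<le> Cu * (2 * \<mu>\<^sup>2 * (k e)\<^sup>2) + Co * (2 * (z e)\<^sup>2)"
      using wo[OF e] by (intro add_mono mult_right_mono) auto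
    finally have "wo e * (o' e)\<^sup>2 \<le> 2 * Cu * \<mu>\<^sup>2 * (k e)\<^sup>2 + 2 * Co * (z e)\<^sup>2" by (simp add: mult_ac)
    moreover have "Cl * (i e)\<^sup>2 \<le> wi e * (i e)\<^sup>2" using wi[OF e] by (intro mult_right_mono) auto
    ultimately show ?thesis by linarith
  qed
  then have "(\<Sum>e\<in>E. wo e * (o' e)\<^sup>2 - wi e * (i e)\<^sup>2)
      \<le> (\<Sum>e\<in>E. 2 * Cu * \<mu>\<^sup>2 * (k e)\<^sup>2 + 2 * Co * (z e)\<^sup>2 - Cl * (i e)\<^sup>2)"
    by (rule sum_mono)
  also have "\<dots> = 2 * Cu * \<mu>\<^sup>2 * (\<Sum>e\<in>E. (k e)\<^sup>2) + Co * (2 * (\<Sum>e\<in>E. (z e)\<^sup>2)) - Cl * (\<Sum>e\<in>E. (i e)\<^sup>2)"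
    by (simp add: sum.distrib sum_subtractf sum_distrib_left mult_ac)
  also have "2 * Cu * \<mu>\<^sup>2 * (\<Sum>e\<in>E. (k e)\<^sup>2) \<le> 2 * Cu * \<mu>\<^sup>2 * (Ch * (\<Sum>e\<in>E. (i e)\<^sup>2))"
    using k Cu by (intro mult_left_mono) auto
  also have "2 * Cu * \<mu>\<^sup>2 * (Ch * (\<Sum>e\<in>E. (i e)\<^sup>2)) + Co * (2 * (\<Sum>e\<in>E. (z e)\<^sup>2)) - Cl * (\<Sum>e\<in>E. (i e)\<^sup>2)
      = Co * (2 * (\<Sum>e\<in>E. (z e)\<^sup>2)) - (Cl - 2 * Cu * Ch * \<mu>\<^sup>2) * (\<Sum>e\<in>E. (i e)\<^sup>2)"
    by (simp add: algebra_simps)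
  also have "\<dots> \<le> Co * (2 * (\<Sum>e\<in>E. (z e)\<^sup>2))" using Cu by (simp add: sum_nonneg)
  finally show ?thesis by simp
qed

text \<open>Double counting: each edge is met once at its tail and once at its head, and without
  loops these are two different nodes.\<close>

lemma sum_nodes_edges:
  fixes f :: "'v \<Rightarrow> 'e \<Rightarrow> real"
  assumes "valid_network N"
  shows "(\<Sum>v\<in>nodes N. \<Sum>e\<in>E0 N v. f v e) = (\<Sum>e\<in>edges N. f (tail (graph N) e) e + f (head (graph N) e) e)"
proof -
  interpret fin_digraph "graph N" using assms by (simp add: valid_network_def)
  interpret loopfree_digraph "graph N" using assms by (simp add: valid_network_def)
  have "(\<Sum>v\<in>nodes N. \<Sum>e\<in>E0 N v. f v e)
      = (\<Sum>v\<in>nodes N. \<Sum>e\<in>edges N. if tail (graph N) e = v \<or> head (graph N) e = v then f v e else 0)"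
    by (simp add: E0_def sum.inter_filter)
  also have "\<dots> = (\<Sum>e\<in>edges N. \<Sum>v\<in>nodes N. if tail (graph N) e = v \<or> head (graph N) e = v then f v e else 0)"
    by (rule sum.swap)
  also have "\<dots> = (\<Sum>e\<in>edges N. f (tail (graph N) e) e + f (head (graph N) e) e)"
  proof (rule sum.cong[OF refl])
    fix e assume e: "e \<in> edges N"
    have "(\<Sum>v\<in>nodes N. if tail (graph N) e = v \<or> head (graph N) e = v then f v e else 0)
        = (\<Sum>v\<in>{tail (graph N) e, head (graph N) e}. f v e)"
      using e by (intro sum.mono_neutral_cong_right) auto
    also have "\<dots> = f (tail (graph N) e) e + f (head (graph N) e) e" using no_loops[OF e] by simp
    finally show "(\<Sum>v\<in>nodes N. if tail (graph N) e = v \<or> head (graph N) e = v then f v e else 0)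
        = f (tail (graph N) e) e + f (head (graph N) e) e" .
  qed
  finally show ?thesis .
qed

section \<open>Uniform bounds and weighted integrals along an edge\<close>

lemma finite_positive_lower_bound:
  fixes f :: "'a \<Rightarrow> real"
  assumes "finite A" "\<And>x. x \<in> A \<Longrightarrow> 0 < f x"
  obtains m where "0 < m" "\<And>x. x \<in> A \<Longrightarrow> m \<le> f x"
proof
  \<comment> \<open>The inserted 1 keeps the minimum meaningful for empty \<open>A\<close>, that is,
    for a network without edges.\<close>
  show "0 < Min (insert 1 (f ` A))" using assms by (subst Min_gr_iff) auto
  show "Min (insert 1 (f ` A)) \<le> f x" if "x \<in> A" for x using assms that by (intro Min_le) auto
qed

text \<open>Differentiation under the integral sign, justified by joint continuity of the integrand
  and of its time derivative on the rectangle. Integrability of both is recorded because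
  inequalities between them are integrated later.\<close>

lemma weighted_energy_deriv:
  fixes d :: "real \<Rightarrow> real \<Rightarrow> real \<times> real"
  assumes d: "C1_rect T l d" and pos: "0 < T" "0 < l"
    and gh: "continuous_on {0..l} g" "continuous_on {0..l} h" and t: "t \<in> {0..T}"
  shows "((\<lambda>t. integral {0..l} (\<lambda>x. g x * (fst (d t x))\<^sup>2 + h x * (snd (d t x))\<^sup>2)) has_real_derivative
      integral {0..l} (\<lambda>x. 2 * g x * fst (d t x) * fst (dt T d t x) + 2 * h x * snd (d t x) * snd (dt T d t x)))
      (at t within {0..T})" (is ?deriv)
    and "(\<lambda>x. g x * (fst (d t x))\<^sup>2 + h x * (snd (d t x))\<^sup>2) integrable_on {0..l}" (is ?int)
    and "(\<lambda>x. 2 * g x * fst (d t x) * fst (dt T d t x) + 2 * h x * snd (d t x) * snd (dt T d t x))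
      integrable_on {0..l}" (is ?int')
proof -
  let ?Q = "{0..T} \<times> {0..l}"
  have c: "continuous_on ?Q (\<lambda>z. d (fst z) (snd z))" "continuous_on ?Q (\<lambda>z. dt T d (fst z) (snd z))"
    using C1_rect_continuous[OF d pos] C1_rect_vd(3)[OF d pos] by (simp_all add: split_beta)
  have gh': "continuous_on ?Q (\<lambda>z. g (snd z))" "continuous_on ?Q (\<lambda>z. h (snd z))"
    using gh by (auto intro!: continuous_on_compose2[of _ _ ?Q snd] continuous_intros)
  have cf': "continuous_on ?Q (\<lambda>(t, x).
      2 * g x * fst (d t x) * fst (dt T d t x) + 2 * h x * snd (d t x) * snd (dt T d t x))"
    unfolding split_beta by (intro continuous_intros c gh')
  have cf: "continuous_on ?Q (\<lambda>(t, x). g x * (fst (d t x))\<^sup>2 + h x * (snd (d t x))\<^sup>2)"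
    unfolding split_beta by (intro continuous_intros c gh')
  have slice: "continuous_on {0..l} (f t)" if "continuous_on ?Q (\<lambda>(t, x). f t x)" "t \<in> {0..T}"
    for f :: "real \<Rightarrow> real \<Rightarrow> real" and t
    using continuous_on_compose2[OF that(1), of "{0..l}" "Pair t"] that(2)
    by (force simp: continuous_on_Pair image_subset_iff)
  have int: "(\<lambda>x. g x * (fst (d t x))\<^sup>2 + h x * (snd (d t x))\<^sup>2) integrable_on {0..l}" if "t \<in> {0..T}" for t
    using slice[OF cf that] by (rule integrable_continuous_real)
  then show ?int using t .
  show ?int' using slice[OF cf' t] by (rule integrable_continuous_real)
  have "((\<lambda>t. integral (cbox 0 l) (\<lambda>x. g x * (fst (d t x))\<^sup>2 + h x * (snd (d t x))\<^sup>2)) has_real_derivative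
      integral (cbox 0 l) (\<lambda>x. 2 * g x * fst (d t x) * fst (dt T d t x) + 2 * h x * snd (d t x) * snd (dt T d t x)))
      (at t within {0..T})"
  proof (rule leibniz_rule_field_derivative)
    fix t x assume "t \<in> {0..T}" "x \<in> cbox 0 l"
    then have v: "((\<lambda>s. d s x) has_vector_derivative dt T d t x) (at t within {0..T})"
      using C1_rect_vd(1)[OF d pos] by auto
    have "((\<lambda>s. fst (d s x)) has_real_derivative fst (dt T d t x)) (at t within {0..T})"
      "((\<lambda>s. snd (d s x)) has_real_derivative snd (dt T d t x)) (at t within {0..T})"
      using bounded_linear.has_vector_derivative[OF bounded_linear_fst v]
        bounded_linear.has_vector_derivative[OF bounded_linear_snd v]
      by (simp_all add: has_real_derivative_iff_has_vector_derivative)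
    then show "((\<lambda>t. g x * (fst (d t x))\<^sup>2 + h x * (snd (d t x))\<^sup>2) has_real_derivative
        2 * g x * fst (d t x) * fst (dt T d t x) + 2 * h x * snd (d t x) * snd (dt T d t x)) (at t within {0..T})"
      by (auto intro!: derivative_eq_intros)
  qed (use int cf' t in auto)
  then show ?deriv by simp
qed

lemma kappa_bounds:
  assumes "0 < len N e" "0 < Bp e" "0 < Bm e" and x: "x \<in> {0..len N e}"
  shows "h_p Bp \<psi> e x \<le> kappa N Bp Bm \<psi> e * h_m Bm \<psi> e x"
    and "h_m Bm \<psi> e x \<le> kappa N Bp Bm \<psi> e * h_p Bp \<psi> e x"
    and "1 \<le> kappa N Bp Bm \<psi> e"
proof -
  let ?m = "\<lambda>x. max (h_p Bp \<psi> e x / h_m Bm \<psi> e x) (h_m Bm \<psi> e x / h_p Bp \<psi> e x)"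
  have pos: "0 < h_p Bp \<psi> e x" "0 < h_m Bm \<psi> e x" for x
    using assms by (simp_all add: h_p_def h_m_def)
  have "continuous_on {0..len N e} ?m"
    using assms unfolding h_p_def h_m_def by (intro continuous_intros) auto
  then have "bdd_above (?m ` {0..len N e})"
    by (intro bounded_imp_bdd_above compact_imp_bounded compact_continuous_image) auto
  then have le: "?m x \<le> kappa N Bp Bm \<psi> e"
    unfolding kappa_def using x by (intro cSUP_upper)
  then show a: "h_p Bp \<psi> e x \<le> kappa N Bp Bm \<psi> e * h_m Bm \<psi> e x"
    and b: "h_m Bm \<psi> e x \<le> kappa N Bp Bm \<psi> e * h_p Bp \<psi> e x"
    using pos[of x] by (simp_all add: pos_divide_le_eq)
  show "1 \<le> kappa N Bp Bm \<psi> e"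
  \<comment> \<open>The two quotients are reciprocal, so one of them is at least 1.\<close>
  proof (cases "h_m Bm \<psi> e x \<le> h_p Bp \<psi> e x")
    case True
    then have "1 \<le> h_p Bp \<psi> e x / h_m Bm \<psi> e x" using pos[of x] by simp
    then show ?thesis using le by linarith
  next
    case False
    then have "1 \<le> h_m Bm \<psi> e x / h_p Bp \<psi> e x" using pos[of x] by simp
    then show ?thesis using le by linarith
  qed
qed

section \<open>The difference system and its Lyapunov function\<close>

locale perturbed_flow =
  fixes N :: "('v, 'e) network"
    and p :: "real \<Rightarrow> real"
    and \<mu> :: "'v \<Rightarrow> real"
    and u :: "'v \<Rightarrow> real \<Rightarrow> real"
    and Z :: "'e \<Rightarrow> real \<Rightarrow> real \<Rightarrow> real \<times> real"
    and J y z :: "'e \<Rightarrow> real \<Rightarrow> real \<times> real"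
    and S R :: "'e \<Rightarrow> real \<Rightarrow> real \<Rightarrow> real \<times> real"
    and U :: "(real \<times> real) set"
    and M T Mhat c \<epsilon> \<beta> :: real
  assumes network: "valid_network N"
    and pressure: "pressure_law p"
    and \<mu>: "\<And>v. v \<in> nodes N \<Longrightarrow> 0 \<le> \<mu> v \<and> \<mu> v \<le> 1"
    and steady: "steady_state_S N p \<mu> J"
    and J_le: "\<And>e x. e \<in> edges N \<Longrightarrow> x \<in> {0..len N e} \<Longrightarrow> \<bar>fst (J e x) - snd (J e x)\<bar> \<le> M"
    and T_pos: "0 < T"
    and sol_S: "classical_S N p \<mu> T u y S"
    and sol_R: "classical_R N p \<mu> T u Z S z R"
    and S_J: "\<And>e. e \<in> edges N \<Longrightarrow> C1_norm T (len N e) (\<lambda>t x. fst (S e t x) - fst (J e x)) \<le> M \<and>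
           C1_norm T (len N e) (\<lambda>t x. snd (S e t x) - snd (J e x)) \<le> M"
    and R_J: "\<And>e. e \<in> edges N \<Longrightarrow> C1_norm T (len N e) (\<lambda>t x. fst (R e t x) - fst (J e x)) \<le> M \<and>
           C1_norm T (len N e) (\<lambda>t x. snd (R e t x) - snd (J e x)) \<le> M"
    and c_pos: "0 < c"
    and bounds: "\<And>e t x. e \<in> edges N \<Longrightarrow> t \<in> {0..T} \<Longrightarrow> x \<in> {0..len N e} \<Longrightarrow>
           \<bar>dx (len N e) (\<lambda>t x. fst (S e t x)) t x\<bar> \<le> Mhat \<and>
           \<bar>dx (len N e) (\<lambda>t x. snd (S e t x)) t x\<bar> \<le> Mhat \<and>
           3/4 * c \<le> lam_p p (R e t x) \<and> lam_p p (R e t x) \<le> 5/4 * c \<and>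
           - (5/4) * c \<le> lam_m p (R e t x) \<and> lam_m p (R e t x) \<le> - (3/4) * c \<and>
           \<bar>dx (len N e) (\<lambda>t x. lam_p p (R e t x)) t x\<bar> \<le> \<epsilon> \<and>
           \<bar>dx (len N e) (\<lambda>t x. lam_m p (R e t x)) t x\<bar> \<le> \<epsilon>"
    and U: "convex U" "U \<subseteq> state_domain p"
    and S_R_in_U: "\<And>e t x. e \<in> edges N \<Longrightarrow> t \<in> {0..T} \<Longrightarrow> x \<in> {0..len N e} \<Longrightarrow>
           S e t x \<in> U \<and> R e t x \<in> U"
    and \<beta>: "0 < \<beta>"
      "\<And>a b. (a, b) \<in> U \<Longrightarrow>
           \<bar>deriv (\<lambda>r. lam_p p (r, b)) a\<bar> \<le> \<beta> \<and> \<bar>deriv (\<lambda>r. lam_p p (a, r)) b\<bar> \<le> \<beta> \<and>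
           \<bar>deriv (\<lambda>r. lam_m p (r, b)) a\<bar> \<le> \<beta> \<and> \<bar>deriv (\<lambda>r. lam_m p (a, r)) b\<bar> \<le> \<beta>"
begin

section \<open>The difference of the two solutions and its equations\<close>

definition \<delta> :: "'e \<Rightarrow> real \<Rightarrow> real \<Rightarrow> real \<times> real" where
  "\<delta> e t x = R e t x - S e t x"

sublocale fin_digraph "graph N"
  using network by (simp add: valid_network_def)

sublocale loopfree_digraph "graph N"
  using network by (simp add: valid_network_def)

lemma len_pos: "e \<in> edges N \<Longrightarrow> 0 < len N e"
  and nu_pos: "e \<in> edges N \<Longrightarrow> 0 < nu N e"
  using network by (auto simp: valid_network_def nu_def theta_def)

lemma finite_E0: "finite (E0 N v)"
  by (simp add: E0_def)

lemma C1_S: "e \<in> edges N \<Longrightarrow> C1_rect T (len N e) (S e)"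
  and C1_R: "e \<in> edges N \<Longrightarrow> C1_rect T (len N e) (R e)"
  using sol_S sol_R by (auto simp: classical_S_def classical_R_def C1_pde_def)

lemma C1_J: "e \<in> edges N \<Longrightarrow> C1_rect T (len N e) (\<lambda>t. J e)"
  using steady T_pos unfolding steady_state_S_def classical_S_def C1_pde_def by blast

lemma C1_\<delta>: "e \<in> edges N \<Longrightarrow> C1_rect T (len N e) (\<delta> e)"
  using C1_rect_diff[OF C1_R C1_S] by (simp add: \<delta>_def[abs_def])

context
  fixes e t x
  assumes e: "e \<in> edges N" and t: "t \<in> {0..T}" and x: "x \<in> {0..len N e}"
begin

text \<open>Triangle inequality: each component of \<open>G\<close> is within \<open>M\<close> of
  that of \<open>J\<close>, and the components of \<open>J\<close> differ by at most
  \<open>M\<close>.\<close>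

lemma component_difference_le:
  assumes G: "C1_rect T (len N e) G"
    and norms: "C1_norm T (len N e) (\<lambda>t x. fst (G t x) - fst (J e x)) \<le> M"
      "C1_norm T (len N e) (\<lambda>t x. snd (G t x) - snd (J e x)) \<le> M"
  shows "\<bar>fst (G t x) - snd (G t x)\<bar> \<le> 3 * M"
proof -
  have "C1_rect T (len N e) (\<lambda>t x. fst (G t x) - fst (J e x))"
    "C1_rect T (len N e) (\<lambda>t x. snd (G t x) - snd (J e x))"
    using C1_rect_bounded_linear[OF C1_rect_diff[OF G C1_J[OF e]] bounded_linear_fst]
      C1_rect_bounded_linear[OF C1_rect_diff[OF G C1_J[OF e]] bounded_linear_snd] by simp_all
  from this[THEN C1_norm_abs_le, OF T_pos len_pos[OF e] t x]
  show ?thesis using norms J_le[OF e x] by linarith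
qed

text \<open>Friction is monotone in the difference of the components, so its increment is a
  nonnegative slope times the increment of that difference. The slope is at most
  \<open>nu N e\<close> times the bounds \<open>3 * M\<close> for \<open>R\<close> and for
  \<open>S\<close> together; the factor 2 from differentiating squares later turns 6 into the 12 of
  the condition on \<open>\<psi>\<close>.\<close>

lemma friction_slope:
  "\<exists>s. 0 \<le> s \<and> s \<le> 6 * nu N e * M \<and>
     sigma N e (R e t x) - sigma N e (S e t x) = s * (fst (\<delta> e t x) - snd (\<delta> e t x))"
proof -
  let ?r = "fst (R e t x) - snd (R e t x)" and ?s = "fst (S e t x) - snd (S e t x)"
  obtain m where m: "0 \<le> m" "m \<le> \<bar>?r\<bar> + \<bar>?s\<bar>" "\<bar>?r\<bar> * ?r - \<bar>?s\<bar> * ?s = m * (?r - ?s)"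
    using abs_mult_self_slope by blast
  have "\<bar>?r\<bar> \<le> 3 * M" "\<bar>?s\<bar> \<le> 3 * M"
    using component_difference_le[OF C1_R[OF e]] component_difference_le[OF C1_S[OF e]]
      R_J[OF e] S_J[OF e] by auto
  then have "m \<le> 6 * M" using m by linarith
  then have "nu N e * m \<le> nu N e * (6 * M)" using nu_pos[OF e] by (intro mult_left_mono) auto
  moreover have "0 \<le> nu N e * m" using m nu_pos[OF e] by simp
  moreover have "sigma N e (R e t x) - sigma N e (S e t x) = nu N e * (\<bar>?r\<bar> * ?r - \<bar>?s\<bar> * ?s)"
    by (simp add: sigma_def algebra_simps)
  then have "sigma N e (R e t x) - sigma N e (S e t x)
      = nu N e * m * (fst (\<delta> e t x) - snd (\<delta> e t x))"
    unfolding m(3) by (simp add: \<delta>_def algebra_simps)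
  ultimately show ?thesis by (intro exI[of _ "nu N e * m"]) auto
qed

text \<open>Subtract the equations of \<open>R\<close> and \<open>S\<close> and split the difference
  of the transport terms: the eigenvalue at \<open>R\<close> acts on the derivative of
  \<open>\<delta>\<close>, and the change of the eigenvalue acts on the derivative of
  \<open>S\<close>.\<close>

lemma \<delta>_pde:
  "fst (dt T (\<delta> e) t x) + lam_p p (R e t x) * fst (dx (len N e) (\<delta> e) t x)
      + (lam_p p (R e t x) - lam_p p (S e t x)) * fst (dx (len N e) (S e) t x)
    = - (sigma N e (R e t x) - sigma N e (S e t x))"
  "snd (dt T (\<delta> e) t x) + lam_m p (R e t x) * snd (dx (len N e) (\<delta> e) t x)
      + (lam_m p (R e t x) - lam_m p (S e t x)) * snd (dx (len N e) (S e) t x)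
    = sigma N e (R e t x) - sigma N e (S e t x)"
proof -
  have d: "dt T (\<delta> e) t x = dt T (R e) t x - dt T (S e) t x"
    "dx (len N e) (\<delta> e) t x = dx (len N e) (R e) t x - dx (len N e) (S e) t x"
    using dt_dx_diff[OF C1_R[OF e] C1_S[OF e] T_pos len_pos[OF e] t x] by (simp_all add: \<delta>_def[abs_def])
  have S: "fst (dt T (S e) t x) + lam_p p (S e t x) * fst (dx (len N e) (S e) t x) = - sigma N e (S e t x)"
    "snd (dt T (S e) t x) + lam_m p (S e t x) * snd (dx (len N e) (S e) t x) = sigma N e (S e t x)"
    using sol_S e t x unfolding classical_S_def C1_pde_def by blast+
  have R: "fst (dt T (R e) t x) + lam_p p (R e t x) * fst (dx (len N e) (R e) t x) = - sigma N e (R e t x)"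
    "snd (dt T (R e) t x) + lam_m p (R e t x) * snd (dx (len N e) (R e) t x) = sigma N e (R e t x)"
    using sol_R e t x unfolding classical_R_def C1_pde_def by blast+
  show "fst (dt T (\<delta> e) t x) + lam_p p (R e t x) * fst (dx (len N e) (\<delta> e) t x)
      + (lam_p p (R e t x) - lam_p p (S e t x)) * fst (dx (len N e) (S e) t x)
    = - (sigma N e (R e t x) - sigma N e (S e t x))"
    using S(1) R(1) unfolding d by (simp add: algebra_simps)
  show "snd (dt T (\<delta> e) t x) + lam_m p (R e t x) * snd (dx (len N e) (\<delta> e) t x)
      + (lam_m p (R e t x) - lam_m p (S e t x)) * snd (dx (len N e) (S e) t x)
    = sigma N e (R e t x) - sigma N e (S e t x)"
    using S(2) R(2) unfolding d by (simp add: algebra_simps)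
qed

lemma eigenvalue_lipschitz:
  "\<bar>lam_p p (R e t x) - lam_p p (S e t x)\<bar> \<le> \<beta> * (\<bar>fst (\<delta> e t x)\<bar> + \<bar>snd (\<delta> e t x)\<bar>)"
  "\<bar>lam_m p (R e t x) - lam_m p (S e t x)\<bar> \<le> \<beta> * (\<bar>fst (\<delta> e t x)\<bar> + \<bar>snd (\<delta> e t x)\<bar>)"
  using S_R_in_U[OF e t x] \<beta>(2) char_speed_lipschitz[OF pressure U, of _ \<beta> "R e t x" "S e t x"]
  by (simp_all add: \<delta>_def lam_p_char_speed lam_m_char_speed)

lemma \<delta>_components_deriv:
  "((\<lambda>x. fst (\<delta> e t x)) has_real_derivative fst (dx (len N e) (\<delta> e) t x)) (at x within {0..len N e})"
  "((\<lambda>x. snd (\<delta> e t x)) has_real_derivative snd (dx (len N e) (\<delta> e) t x)) (at x within {0..len N e})"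
  using bounded_linear.has_vector_derivative[OF bounded_linear_fst
      C1_rect_vd(2)[OF C1_\<delta>[OF e] T_pos len_pos[OF e] t x]]
    bounded_linear.has_vector_derivative[OF bounded_linear_snd
      C1_rect_vd(2)[OF C1_\<delta>[OF e] T_pos len_pos[OF e] t x]]
  by (simp_all add: has_real_derivative_iff_has_vector_derivative)

text \<open>\<open>dx\<close> is defined by choice and says something only where a derivative
  exists. Its existence makes the bound \<open>\<epsilon>\<close> on \<open>dx\<close> a bound on
  the true derivative of the eigenvalues along the edge.\<close>

lemma char_speed_R_deriv:
  "((\<lambda>x. char_speed p k (R e t x)) has_real_derivative
     dx (len N e) (\<lambda>t x. char_speed p k (R e t x)) t x) (at x within {0..len N e})"
proof -
  have "R e t x \<in> state_domain p" using S_R_in_U[OF e t x] U by blast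
  then obtain D where D: "(sound_speed p has_real_derivative D) (at ((fst (R e t x) + snd (R e t x)) / 2))"
    using sound_speed_differentiable[OF pressure] unfolding state_domain_def by blast
  note v = C1_rect_vd(2)[OF C1_R[OF e] T_pos len_pos[OF e] t x]
  have "\<exists>d. ((\<lambda>x. char_speed p k (R e t x)) has_real_derivative d) (at x within {0..len N e})"
    using char_speed_along_path[where g = "R e t", OF D]
      bounded_linear.has_vector_derivative[OF bounded_linear_fst v]
      bounded_linear.has_vector_derivative[OF bounded_linear_snd v]
    unfolding has_real_derivative_iff_has_vector_derivative by blast
  then show ?thesis
    using vector_derivative_within_closed_interval[OF len_pos[OF e] x] t x
    unfolding has_real_derivative_iff_has_vector_derivative dx_def by metis
qed

end

text \<open>At a node with one edge the boundary data \<open>u\<close> cancel and \<open>K\<close>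
  is the incoming value. At other nodes \<open>R\<close> is fed with the share
  \<open>1 - \<mu> v\<close> of the outgoing value of \<open>S\<close>; subtracting that value
  leaves \<open>- \<mu> v\<close> times it, which is \<open>K\<close> of \<open>S\<close> by the
  node condition of \<open>S\<close>, and \<open>K\<close> is linear.\<close>

lemma \<delta>_node_condition:
  assumes v: "v \<in> nodes N" and e: "e \<in> E0 N v" and t: "t \<in> {0..T}"
  shows "val_out N (\<lambda>e. \<delta> e t) v e
    = \<mu> v * K N (\<lambda>e. \<delta> e t) v e + (1 - \<mu> v) * val_out N (\<lambda>e. Z e t) v e"
proof -
  have out: "val_out N (\<lambda>e. \<delta> e t) v e = val_out N (\<lambda>e. R e t) v e - val_out N (\<lambda>e. S e t) v e"
    and "in": "\<And>e. val_in N (\<lambda>e. \<delta> e t) v e = val_in N (\<lambda>e. R e t) v e - val_in N (\<lambda>e. S e t) v e"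
    by (simp_all add: val_out_def val_in_def \<delta>_def)
  have K: "K N (\<lambda>e. \<delta> e t) v e = K N (\<lambda>e. R e t) v e - K N (\<lambda>e. S e t) v e"
    unfolding K_def "in" by (simp add: algebra_simps sum_subtractf)
  have S: "val_out N (\<lambda>e. S e t) v e =
      (if card (E0 N v) = 1 then (1 - \<mu> v) * u v t + \<mu> v * val_in N (\<lambda>e. S e t) v e
       else K N (\<lambda>e. S e t) v e)"
    using sol_S v e t unfolding classical_S_def node_S_def by blast
  have R: "val_out N (\<lambda>e. R e t) v e =
      (if card (E0 N v) = 1 then (1 - \<mu> v) * (u v t + val_out N (\<lambda>e. Z e t) v e) + \<mu> v * val_in N (\<lambda>e. R e t) v e
       else \<mu> v * K N (\<lambda>e. R e t) v e + (1 - \<mu> v) * (val_out N (\<lambda>e. S e t) v e + val_out N (\<lambda>e. Z e t) v e))"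
    using sol_R v e t unfolding classical_R_def node_R_def by blast
  show ?thesis
  proof (cases "card (E0 N v) = 1")
    case True
    then show ?thesis using S R unfolding out by (simp add: K_def "in" algebra_simps)
  next
    case False
    then show ?thesis using S R unfolding out K by (simp add: algebra_simps)
  qed
qed

lemma classical_Diff_\<delta>: "classical_Diff N p \<mu> T Z S y z \<delta>"
  unfolding classical_Diff_def
proof (intro conjI ballI)
  show "initial_state N (\<lambda>e x. z e x - y e x) \<delta>"
    using sol_S sol_R by (simp add: classical_S_def classical_R_def initial_state_def \<delta>_def)
  show "node_Diff N \<mu> (\<lambda>e. Z e t) (\<lambda>e. \<delta> e t)" if "t \<in> {0..T}" for t
    using \<delta>_node_condition that by (simp add: node_Diff_def)
  fix e assume e: "e \<in> edges N"
  show "C1_rect T (len N e) (\<delta> e)" by (rule C1_\<delta>[OF e])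
  fix t x assume tx: "t \<in> {0..T}" "x \<in> {0..len N e}"
  have R_eq: "S e t x + \<delta> e t x = R e t x" by (simp add: \<delta>_def)
  show "S e t x \<in> state_domain p" "S e t x + \<delta> e t x \<in> state_domain p"
    using S_R_in_U[OF e tx] U unfolding R_eq by auto
  show "fst (dt T (\<delta> e) t x)
            + lam_p p (S e t x + \<delta> e t x) * fst (dx (len N e) (\<delta> e) t x)
            + (lam_p p (S e t x + \<delta> e t x) - lam_p p (S e t x)) * fst (dx (len N e) (S e) t x)
            = - (sigma N e (S e t x + \<delta> e t x) - sigma N e (S e t x))"
    "snd (dt T (\<delta> e) t x)
            + lam_m p (S e t x + \<delta> e t x) * snd (dx (len N e) (\<delta> e) t x)
            + (lam_m p (S e t x + \<delta> e t x) - lam_m p (S e t x)) * snd (dx (len N e) (S e) t x)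
            = sigma N e (S e t x + \<delta> e t x) - sigma N e (S e t x)"
    unfolding R_eq by (rule \<delta>_pde[OF e tx])+
qed

end

text \<open>The weights form a second layer since \<open>\<delta>\<close> has to be fixed before
  \<open>\<psi>\<close> is chosen: one and the same \<open>\<delta>\<close> decays for every
  admissible \<open>\<psi>\<close>.\<close>

locale weighted_perturbed_flow = perturbed_flow N p \<mu> u Z J y z S R U M T Mhat c \<epsilon> \<beta>
  for N :: "('v, 'e) network" and p \<mu> u Z J y z S R U M T Mhat c \<epsilon> \<beta> +
  fixes Bp Bm :: "'e \<Rightarrow> real" and \<psi> :: real
  assumes B_pos: "\<And>e. e \<in> edges N \<Longrightarrow> 0 < Bp e \<and> 0 < Bm e"
    and \<psi>_pos: "0 < \<psi>"
begin

abbreviation "hp \<equiv> h_p Bp \<psi>"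
abbreviation "hm \<equiv> h_m Bm \<psi>"

text \<open>The weighted quadratic energy flux; its boundary values are what the integration by
  parts leaves behind.\<close>

definition flux :: "'e \<Rightarrow> real \<Rightarrow> real \<Rightarrow> real" where
  "flux e t x = hp e x * lam_p p (R e t x) * (fst (\<delta> e t x))\<^sup>2
     + hm e x * lam_m p (R e t x) * (snd (\<delta> e t x))\<^sup>2"

definition lyapunov :: "'e \<Rightarrow> real \<Rightarrow> real" where
  "lyapunov e t = integral {0..len N e} (\<lambda>x. hp e x * (fst (\<delta> e t x))\<^sup>2 + hm e x * (snd (\<delta> e t x))\<^sup>2)"

definition lyapunov_deriv :: "'e \<Rightarrow> real \<Rightarrow> real" where
  "lyapunov_deriv e t = integral {0..len N e} (\<lambda>x. 2 * hp e x * fst (\<delta> e t x) * fst (dt T (\<delta> e) t x)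
     + 2 * hm e x * snd (\<delta> e t x) * snd (dt T (\<delta> e) t x))"

section \<open>Dissipation along a single edge\<close>

lemma h_pos: "e \<in> edges N \<Longrightarrow> 0 < hp e x" "e \<in> edges N \<Longrightarrow> 0 < hm e x"
  using B_pos by (auto simp: h_p_def h_m_def)

lemma h_continuous: "continuous_on A (hp e)" "continuous_on A (hm e)"
  unfolding h_p_def h_m_def by (intro continuous_intros)+

lemma has_real_derivative_lyapunov:
  assumes "e \<in> edges N" "t \<in> {0..T}"
  shows "(lyapunov e has_real_derivative lyapunov_deriv e t) (at t within {0..T})"
  using weighted_energy_deriv(1)[OF C1_\<delta> T_pos len_pos h_continuous] assms
  by (simp add: lyapunov_def[abs_def] lyapunov_deriv_def)

lemma edge_dissipation:
  assumes e: "e \<in> edges N" and t: "t \<in> {0..T}"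
    and \<gamma>: "\<gamma> \<le> 3/4 * \<psi> * c - \<epsilon> - (12 * nu N e * M + 4 * \<beta> * Mhat) * kappa N Bp Bm \<psi> e"
  shows "lyapunov_deriv e t \<le> - \<gamma> * lyapunov e t - (flux e t (len N e) - flux e t 0)"
proof -
  let ?l = "len N e"
  let ?lp' = "\<lambda>x. dx ?l (\<lambda>t x. lam_p p (R e t x)) t x" and ?lm' = "\<lambda>x. dx ?l (\<lambda>t x. lam_m p (R e t x)) t x"
  let ?a = "\<lambda>x. fst (\<delta> e t x)" and ?b = "\<lambda>x. snd (\<delta> e t x)"
  \<comment> \<open>\<open>?F'\<close> is the x-derivative of the flux. The terms with
    \<open>\<psi>\<close> stem from the weights, whose logarithmic derivatives are
    \<open>- \<psi>\<close> and \<open>\<psi>\<close>.\<close>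
  let ?F' = "\<lambda>x. hp e x * ((?lp' x - \<psi> * lam_p p (R e t x)) * (?a x)\<^sup>2
        + 2 * lam_p p (R e t x) * ?a x * fst (dx ?l (\<delta> e) t x))
      + hm e x * ((?lm' x + \<psi> * lam_m p (R e t x)) * (?b x)\<^sup>2
        + 2 * lam_m p (R e t x) * ?b x * snd (dx ?l (\<delta> e) t x))"
  let ?W = "\<lambda>x. hp e x * (?a x)\<^sup>2 + hm e x * (?b x)\<^sup>2"
  let ?I = "\<lambda>x. 2 * hp e x * ?a x * fst (dt T (\<delta> e) t x) + 2 * hm e x * ?b x * snd (dt T (\<delta> e) t x)"
  note energy = weighted_energy_deriv[OF C1_\<delta>[OF e] T_pos len_pos[OF e] h_continuous t]
  have "(flux e t has_vector_derivative ?F' x) (at x within {0..?l})" if x: "x \<in> {0..?l}" for x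
  proof -
    have h: "(hp e has_real_derivative - \<psi> * hp e x) (at x within {0..?l})"
      "(hm e has_real_derivative \<psi> * hm e x) (at x within {0..?l})"
      unfolding h_p_def[abs_def] h_m_def[abs_def] by (auto intro!: derivative_eq_intros)
    show ?thesis
      unfolding flux_def[abs_def] has_real_derivative_iff_has_vector_derivative[symmetric]
      using h \<delta>_components_deriv[OF e t x] char_speed_R_deriv[OF e t x, of 1]
        char_speed_R_deriv[OF e t x, of "- 1"]
      unfolding lam_p_char_speed lam_m_char_speed
      by (auto intro!: derivative_eq_intros simp: algebra_simps)
  qed
  then have F: "(?F' has_integral flux e t ?l - flux e t 0) {0..?l}"
    using len_pos[OF e] by (intro fundamental_theorem_of_calculus) auto
  have W: "(?W has_integral lyapunov e t) {0..?l}"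
    using energy(2) unfolding lyapunov_def by (rule integrable_integral)
  \<comment> \<open>The energy inequality before integration. Integrating it turns
    \<open>?F'\<close> into the difference of the fluxes at the two ends.\<close>
  have ineq: "?I x \<le> - ?F' x - \<gamma> * ?W x" if x: "x \<in> {0..?l}" for x
  proof -
    obtain s where s: "0 \<le> s" "s \<le> 6 * nu N e * M"
      "sigma N e (R e t x) - sigma N e (S e t x) = s * (?a x - ?b x)"
      using friction_slope[OF e t x] by blast
    have B: "0 < Bp e" "0 < Bm e" using B_pos[OF e] by auto
    have bnd: "3/4 * c \<le> lam_p p (R e t x)" "lam_m p (R e t x) \<le> - (3/4) * c"
      "\<bar>?lp' x\<bar> \<le> \<epsilon>" "\<bar>?lm' x\<bar> \<le> \<epsilon>"
      using bounds[OF e t x] by blast+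
    have dxS: "\<bar>fst (dx ?l (S e) t x)\<bar> \<le> Mhat" "\<bar>snd (dx ?l (S e) t x)\<bar> \<le> Mhat"
      using bounds[OF e t x] dt_dx_bounded_linear(2)[OF C1_S[OF e] bounded_linear_fst T_pos len_pos[OF e] t x]
        dt_dx_bounded_linear(2)[OF C1_S[OF e] bounded_linear_snd T_pos len_pos[OF e] t x] by auto
    have "?I x \<le> - (hp e x * ((?lp' x - \<psi> * lam_p p (R e t x)) * (?a x)\<^sup>2
          + 2 * lam_p p (R e t x) * ?a x * fst (dx ?l (\<delta> e) t x)))
        - hm e x * ((?lm' x + \<psi> * lam_m p (R e t x)) * (?b x)\<^sup>2
          + 2 * lam_m p (R e t x) * ?b x * snd (dx ?l (\<delta> e) t x))
        - (3/4 * \<psi> * c - \<epsilon> - (2 * (6 * nu N e * M) + 4 * \<beta> * Mhat) * kappa N Bp Bm \<psi> e) * ?W x"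
    proof (rule dissipation_pointwise)
      show "fst (dt T (\<delta> e) t x) = - lam_p p (R e t x) * fst (dx ?l (\<delta> e) t x)
          - (lam_p p (R e t x) - lam_p p (S e t x)) * fst (dx ?l (S e) t x) - s * (?a x - ?b x)"
        "snd (dt T (\<delta> e) t x) = - lam_m p (R e t x) * snd (dx ?l (\<delta> e) t x)
          - (lam_m p (R e t x) - lam_m p (S e t x)) * snd (dx ?l (S e) t x) + s * (?a x - ?b x)"
        using \<delta>_pde[OF e t x] s(3) by (simp_all add: algebra_simps)
    qed (rule h_pos[OF e] kappa_bounds[where Bp = Bp and Bm = Bm, OF len_pos[OF e] B x] s(1,2) eigenvalue_lipschitz[OF e t x] dxS bnd
        less_imp_le[OF \<psi>_pos] less_imp_le[OF \<beta>(1)])+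
    \<comment> \<open>The rate of this edge may be lowered to the common rate
      \<open>\<gamma>\<close> because the energy density is nonnegative.\<close>
    moreover have "\<gamma> * ?W x \<le> (3/4 * \<psi> * c - \<epsilon> - (2 * (6 * nu N e * M) + 4 * \<beta> * Mhat) * kappa N Bp Bm \<psi> e) * ?W x"
      using \<gamma> h_pos[OF e, of x] by (intro mult_right_mono) (auto simp: less_imp_le mult.assoc)
    ultimately show ?thesis by linarith
  qed
  have I: "(?I has_integral lyapunov_deriv e t) {0..?l}"
    using energy(3) unfolding lyapunov_deriv_def by (rule integrable_integral)
  have "lyapunov_deriv e t \<le> - (flux e t ?l - flux e t 0) - \<gamma> * lyapunov e t"
    by (rule has_integral_le[OF I has_integral_diff[OF has_integral_neg[OF F] has_integral_mult_right[OF W]] ineq])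
  then show ?thesis by simp
qed

section \<open>Boundary terms regrouped by nodes\<close>

definition w_in :: "real \<Rightarrow> 'v \<Rightarrow> 'e \<Rightarrow> real" where
  "w_in t v e = (if xend N v e = 0 then hm e 0 * \<bar>lam_m p (R e t 0)\<bar>
     else hp e (len N e) * lam_p p (R e t (len N e)))"

definition w_out :: "real \<Rightarrow> 'v \<Rightarrow> 'e \<Rightarrow> real" where
  "w_out t v e = (if xend N v e = 0 then hp e 0 * lam_p p (R e t 0)
     else hm e (len N e) * \<bar>lam_m p (R e t (len N e))\<bar>)"

text \<open>At either end of an edge one component enters the node and the other leaves it. As the
  minus eigenvalue is negative, its modulus absorbs a sign, so that outgoing squares count
  positively and incoming ones negatively, at x = 0 as well as at the other end.\<close>

lemma flux_nodes:
  assumes t: "t \<in> {0..T}"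
  shows "(\<Sum>e\<in>edges N. - (flux e t (len N e) - flux e t 0))
    = (\<Sum>v\<in>nodes N. \<Sum>e\<in>E0 N v. w_out t v e * (val_out N (\<lambda>e. \<delta> e t) v e)\<^sup>2
        - w_in t v e * (val_in N (\<lambda>e. \<delta> e t) v e)\<^sup>2)"
  unfolding sum_nodes_edges[OF network]
proof (rule sum.cong[OF refl])
  fix e assume e: "e \<in> edges N"
  have "xend N (tail (graph N) e) e = 0" "xend N (head (graph N) e) e = len N e" "len N e \<noteq> 0"
    using no_loops[OF e] len_pos[OF e] by (auto simp: xend_def)
  moreover have "lam_m p (R e t 0) < 0" "lam_m p (R e t (len N e)) < 0"
    using bounds[OF e t, of 0] bounds[OF e t, of "len N e"] len_pos[OF e] c_pos by auto
  ultimately show "- (flux e t (len N e) - flux e t 0) =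
      w_out t (tail (graph N) e) e * (val_out N (\<lambda>e. \<delta> e t) (tail (graph N) e) e)\<^sup>2
      - w_in t (tail (graph N) e) e * (val_in N (\<lambda>e. \<delta> e t) (tail (graph N) e) e)\<^sup>2
      + (w_out t (head (graph N) e) e * (val_out N (\<lambda>e. \<delta> e t) (head (graph N) e) e)\<^sup>2
      - w_in t (head (graph N) e) e * (val_in N (\<lambda>e. \<delta> e t) (head (graph N) e) e)\<^sup>2)"
    by (simp add: w_in_def w_out_def val_in_def val_out_def flux_def)
qed

lemma C_lower_le:
  assumes "e \<in> E0 N v"
  shows "C_lower N p Bp Bm \<psi> R v t \<le> w_in t v e"
  unfolding C_lower_def
proof (rule Min_le)
  show "w_in t v e \<in> (\<lambda>e. hp e (len N e) * lam_p p (R e t (len N e))) ` I_L N v \<union>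
      (\<lambda>e. hm e 0 * \<bar>lam_m p (R e t 0)\<bar>) ` I_0 N v"
    using assms by (auto simp: w_in_def I_L_def I_0_def xend_def split: if_splits)
qed (use finite_E0[of v] in \<open>auto simp: I_L_def I_0_def\<close>)

lemma le_C_upper:
  assumes "e \<in> E0 N v"
  shows "w_out t v e \<le> C_upper N p Bp Bm \<psi> R v t"
  unfolding C_upper_def
proof (rule Max_ge)
  show "w_out t v e \<in> (\<lambda>e. hm e (len N e) * \<bar>lam_m p (R e t (len N e))\<bar>) ` I_L N v \<union>
      (\<lambda>e. hp e 0 * lam_p p (R e t 0)) ` I_0 N v"
    using assms by (auto simp: w_out_def I_L_def I_0_def xend_def split: if_splits)
qed (use finite_E0[of v] in \<open>auto simp: I_L_def I_0_def\<close>)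

text \<open>The upper bound depends neither on time nor on the node or the edge. It becomes the
  factor in front of \<open>\<eta>\<close>.\<close>

lemma w_out_bounds:
  assumes e: "e \<in> edges N" and t: "t \<in> {0..T}"
  shows "0 \<le> w_out t v e" and "w_out t v e \<le> 5/4 * c * (\<Sum>e\<in>edges N. hp e 0 + hm e (len N e))"
proof -
  have l: "0 \<in> {0..len N e}" "len N e \<in> {0..len N e}" using len_pos[OF e] by auto
  have lam: "0 \<le> lam_p p (R e t 0)" "lam_p p (R e t 0) \<le> 5/4 * c" "\<bar>lam_m p (R e t (len N e))\<bar> \<le> 5/4 * c"
    using bounds[OF e t l(1)] bounds[OF e t l(2)] c_pos by auto
  show "0 \<le> w_out t v e"
    using lam h_pos[OF e] by (simp add: w_out_def less_imp_le)
  have "w_out t v e \<le> (hp e 0 + hm e (len N e)) * (5/4 * c)"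
  proof (cases "xend N v e = 0")
    case True
    have "hp e 0 * lam_p p (R e t 0) \<le> (hp e 0 + hm e (len N e)) * (5/4 * c)"
      using lam h_pos[OF e] by (intro mult_mono) (auto simp: less_imp_le add_nonneg_nonneg)
    then show ?thesis using True by (simp add: w_out_def)
  next
    case False
    have "hm e (len N e) * \<bar>lam_m p (R e t (len N e))\<bar> \<le> (hp e 0 + hm e (len N e)) * (5/4 * c)"
      using lam h_pos[OF e] by (intro mult_mono) (auto simp: less_imp_le add_nonneg_nonneg)
    then show ?thesis using False by (simp add: w_out_def)
  qed
  also have "\<dots> \<le> (\<Sum>e\<in>edges N. hp e 0 + hm e (len N e)) * (5/4 * c)"
  proof (rule mult_right_mono)
    show "hp e 0 + hm e (len N e) \<le> (\<Sum>e\<in>edges N. hp e 0 + hm e (len N e))"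
      using e h_pos by (intro member_le_sum) (auto simp: less_imp_le add_nonneg_nonneg)
  qed (use c_pos in auto)
  finally show "w_out t v e \<le> 5/4 * c * (\<Sum>e\<in>edges N. hp e 0 + hm e (len N e))"
    by (simp add: mult.commute)
qed

lemma node_flux_le:
  assumes v: "v \<in> nodes N" and t: "t \<in> {0..T}" and K: "K_bound N v Chat"
    and C: "E0 N v \<noteq> {} \<Longrightarrow> 0 \<le> C_lower N p Bp Bm \<psi> R v t - 2 * C_upper N p Bp Bm \<psi> R v t * Chat * \<bar>\<mu> v\<bar>\<^sup>2"
  shows "(\<Sum>e\<in>E0 N v. w_out t v e * (val_out N (\<lambda>e. \<delta> e t) v e)\<^sup>2
      - w_in t v e * (val_in N (\<lambda>e. \<delta> e t) v e)\<^sup>2)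
    \<le> 5/4 * c * (\<Sum>e\<in>edges N. hp e 0 + hm e (len N e)) * (2 * (norm_out N (\<lambda>e. Z e t) v)\<^sup>2)"
\<comment> \<open>At an isolated node both sides vanish; \<open>C_lower\<close> and
  \<open>C_upper\<close> would be extrema of the empty set there.\<close>
proof (cases "E0 N v = {}")
  case True
  then show ?thesis by (simp add: norm_out_def)
next
  case False
  have edge: "e \<in> edges N" if "e \<in> E0 N v" for e using that by (simp add: E0_def)
  have "(\<Sum>e\<in>E0 N v. w_out t v e * (val_out N (\<lambda>e. \<delta> e t) v e)\<^sup>2
      - w_in t v e * (val_in N (\<lambda>e. \<delta> e t) v e)\<^sup>2)
    \<le> 5/4 * c * (\<Sum>e\<in>edges N. hp e 0 + hm e (len N e)) * (2 * (\<Sum>e\<in>E0 N v. (val_out N (\<lambda>e. Z e t) v e)\<^sup>2))"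
  proof (rule node_dissipation[OF finite_E0 \<delta>_node_condition[OF v _ t]])
    show "(\<Sum>e\<in>E0 N v. (K N (\<lambda>e. \<delta> e t) v e)\<^sup>2) \<le> Chat * (\<Sum>e\<in>E0 N v. (val_in N (\<lambda>e. \<delta> e t) v e)\<^sup>2)"
      using K[unfolded K_bound_def, rule_format, of "\<lambda>e. \<delta> e t"]
      by (simp add: norm_in_def L2_set_def sum_nonneg)
    \<comment> \<open>Any incident edge shows the maximum to be nonnegative, as its own outgoing
      weight is.\<close>
    obtain e where "e \<in> E0 N v" using False by blast
    then show "0 \<le> C_upper N p Bp Bm \<psi> R v t"
      using w_out_bounds(1)[OF edge t] le_C_upper order_trans by blast
    show "0 \<le> C_lower N p Bp Bm \<psi> R v t - 2 * C_upper N p Bp Bm \<psi> R v t * Chat * (\<mu> v)\<^sup>2"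
      using C[OF False] by simp
  qed (use \<mu>[OF v] edge t w_out_bounds C_lower_le le_C_upper in auto)
  then show ?thesis by (simp add: norm_out_def L2_set_def sum_nonneg)
qed

section \<open>Decay of the weighted energy and of the L^2 energy\<close>

lemma lyapunov_decay:
  assumes \<gamma>: "0 < \<gamma>" "\<And>e. e \<in> edges N \<Longrightarrow>
      \<gamma> \<le> 3/4 * \<psi> * c - \<epsilon> - (12 * nu N e * M + 4 * \<beta> * Mhat) * kappa N Bp Bm \<psi> e"
    and K: "\<And>v. v \<in> nodes N \<Longrightarrow> K_bound N v (Chat v)"
    and C: "\<And>v t. v \<in> nodes N \<Longrightarrow> E0 N v \<noteq> {} \<Longrightarrow> t \<in> {0..T} \<Longrightarrow>
      0 \<le> C_lower N p Bp Bm \<psi> R v t - 2 * C_upper N p Bp Bm \<psi> R v t * Chat v * \<bar>\<mu> v\<bar>\<^sup>2"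
    and Z: "\<And>t. t \<in> {0..T} \<Longrightarrow> (\<Sum>v\<in>nodes N. 2 * (norm_out N (\<lambda>e. Z e t) v)\<^sup>2) \<le> \<eta>"
    and t: "t \<in> {0..T}"
  shows "(\<Sum>e\<in>edges N. lyapunov e t) \<le> exp (- \<gamma> * t) * (\<Sum>e\<in>edges N. lyapunov e 0)
    + 5/4 * c * (\<Sum>e\<in>edges N. hp e 0 + hm e (len N e)) * \<eta> / \<gamma>"
proof (rule gronwall_exponential_decay[where L' = "\<lambda>t. \<Sum>e\<in>edges N. lyapunov_deriv e t"])
  \<comment> \<open>Gronwall's inequality is applied to the total energy with the constant source
    \<open>?C * \<eta>\<close>. That source is nonnegative, since \<open>\<eta>\<close> bounds a sum
    of squares.\<close>
  let ?C = "5/4 * c * (\<Sum>e\<in>edges N. hp e 0 + hm e (len N e))"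
  have C_nonneg: "0 \<le> ?C"
    using h_pos c_pos by (intro mult_nonneg_nonneg sum_nonneg add_nonneg_nonneg) (auto simp: less_imp_le)
  have "0 \<le> (\<Sum>v\<in>nodes N. 2 * (norm_out N (\<lambda>e. Z e t) v)\<^sup>2)" by (intro sum_nonneg) auto
  also have "\<dots> \<le> \<eta>" using Z[OF t] .
  finally show "0 \<le> ?C * \<eta>" using C_nonneg by simp
  fix t assume t: "t \<in> {0..T}"
  show "((\<lambda>t. \<Sum>e\<in>edges N. lyapunov e t) has_real_derivative (\<Sum>e\<in>edges N. lyapunov_deriv e t))
      (at t within {0..T})"
    using has_real_derivative_lyapunov[OF _ t] by (intro DERIV_sum)
  have "(\<Sum>e\<in>edges N. lyapunov_deriv e t)
      \<le> (\<Sum>e\<in>edges N. - \<gamma> * lyapunov e t - (flux e t (len N e) - flux e t 0))"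
    using edge_dissipation[OF _ t \<gamma>(2)] by (intro sum_mono)
  also have "\<dots> = - \<gamma> * (\<Sum>e\<in>edges N. lyapunov e t) + (\<Sum>e\<in>edges N. - (flux e t (len N e) - flux e t 0))"
    by (simp add: sum.distrib sum_subtractf sum_distrib_left sum_negf)
  also have "(\<Sum>e\<in>edges N. - (flux e t (len N e) - flux e t 0))
      \<le> (\<Sum>v\<in>nodes N. ?C * (2 * (norm_out N (\<lambda>e. Z e t) v)\<^sup>2))"
    unfolding flux_nodes[OF t] using node_flux_le[OF _ t K C[OF _ _ t]] by (intro sum_mono)
  also have "\<dots> = ?C * (\<Sum>v\<in>nodes N. 2 * (norm_out N (\<lambda>e. Z e t) v)\<^sup>2)"
    by (simp only: sum_distrib_left)
  also have "\<dots> \<le> ?C * \<eta>" using Z[OF t] C_nonneg by (rule mult_left_mono)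
  finally show "(\<Sum>e\<in>edges N. lyapunov_deriv e t) \<le> - \<gamma> * (\<Sum>e\<in>edges N. lyapunov e t) + ?C * \<eta>"
    by simp
qed (use \<gamma> t in auto)

text \<open>Equivalence of the weighted and the plain energy: \<open>hp\<close> decreases and
  \<open>hm\<close> increases along an edge, so their extreme values are taken at the ends. The sum
  of the largest values over all edges serves as a common upper bound.\<close>

lemma lyapunov_bounds:
  assumes m: "\<And>e. e \<in> edges N \<Longrightarrow> m \<le> hp e (len N e) \<and> m \<le> hm e 0" and t: "t \<in> {0..T}"
  shows "m * L2_energy N \<delta> t \<le> (\<Sum>e\<in>edges N. lyapunov e t)"
    and "(\<Sum>e\<in>edges N. lyapunov e t) \<le> (\<Sum>e\<in>edges N. hp e 0 + hm e (len N e)) * L2_energy N \<delta> t"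
proof -
  let ?H = "\<Sum>e\<in>edges N. hp e 0 + hm e (len N e)"
  let ?E = "\<lambda>e. integral {0..len N e} (\<lambda>x. \<bar>fst (\<delta> e t x)\<bar>\<^sup>2 + \<bar>snd (\<delta> e t x)\<bar>\<^sup>2)"
  have *: "m * ?E e \<le> lyapunov e t \<and> lyapunov e t \<le> ?H * ?E e" if e: "e \<in> edges N" for e
  proof -
    let ?f = "\<lambda>x. \<bar>fst (\<delta> e t x)\<bar>\<^sup>2 + \<bar>snd (\<delta> e t x)\<bar>\<^sup>2"
    note w = weighted_energy_deriv(2)[OF C1_\<delta>[OF e] T_pos len_pos[OF e]]
    \<comment> \<open>The plain energy is the weighted one with both weights equal to 1.\<close>
    have f: "?f integrable_on {0..len N e}"
      using w[OF continuous_on_const[of _ 1] continuous_on_const[of _ 1] t] by simp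
    have kf: "(\<lambda>x. k * ?f x) integrable_on {0..len N e}" for k
      using integrable_cmul[OF f, of k] by simp
    have H: "hp e 0 + hm e (len N e) \<le> ?H"
      using e h_pos by (intro member_le_sum) (auto simp: less_imp_le add_nonneg_nonneg)
    have h: "m \<le> hp e x" "m \<le> hm e x" "hp e x \<le> ?H" "hm e x \<le> ?H" if x: "x \<in> {0..len N e}" for x
    proof -
      have "hp e (len N e) \<le> hp e x" "hp e x \<le> hp e 0" "hm e 0 \<le> hm e x" "hm e x \<le> hm e (len N e)"
        using B_pos[OF e] \<psi>_pos x by (auto simp: h_p_def h_m_def)
      then show "m \<le> hp e x" "m \<le> hm e x" "hp e x \<le> ?H" "hm e x \<le> ?H"
        using m[OF e] H h_pos(1)[OF e, of 0] h_pos(2)[OF e, of "len N e"] by linarith+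
    qed
    have "integral {0..len N e} (\<lambda>x. m * ?f x) \<le> lyapunov e t"
      unfolding lyapunov_def
    proof (rule integral_le)
      show "m * ?f x \<le> hp e x * (fst (\<delta> e t x))\<^sup>2 + hm e x * (snd (\<delta> e t x))\<^sup>2" if "x \<in> {0..len N e}" for x
        using h[OF that] by (simp add: distrib_left add_mono mult_right_mono)
    qed (rule kf w[OF h_continuous t])+
    moreover have "lyapunov e t \<le> integral {0..len N e} (\<lambda>x. ?H * ?f x)"
      unfolding lyapunov_def
    proof (rule integral_le)
      show "hp e x * (fst (\<delta> e t x))\<^sup>2 + hm e x * (snd (\<delta> e t x))\<^sup>2 \<le> ?H * ?f x" if "x \<in> {0..len N e}" for x
        unfolding distrib_left using h[OF that] by (intro add_mono) (simp_all add: mult_right_mono)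
    qed (rule kf w[OF h_continuous t])+
    ultimately show ?thesis by simp
  qed
  show "m * L2_energy N \<delta> t \<le> (\<Sum>e\<in>edges N. lyapunov e t)"
    "(\<Sum>e\<in>edges N. lyapunov e t) \<le> ?H * L2_energy N \<delta> t"
    unfolding L2_energy_def sum_distrib_left[where A = "edges N"] using * by (blast intro: sum_mono)+
qed

lemma energy_decay:
  assumes \<psi>: "\<And>e. e \<in> edges N \<Longrightarrow>
      \<epsilon> + (12 * nu N e * M + 4 * \<beta> * Mhat) * kappa N Bp Bm \<psi> e < 3/4 * \<psi> * c"
    and K: "\<And>v. v \<in> nodes N \<Longrightarrow> K_bound N v (Chat v)"
    and C: "\<And>v t. v \<in> nodes N \<Longrightarrow> E0 N v \<noteq> {} \<Longrightarrow> t \<in> {0..T} \<Longrightarrow>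
      0 \<le> C_lower N p Bp Bm \<psi> R v t - 2 * C_upper N p Bp Bm \<psi> R v t * Chat v * \<bar>\<mu> v\<bar>\<^sup>2"
    and Z: "\<And>t. t \<in> {0..T} \<Longrightarrow> (\<Sum>v\<in>nodes N. 2 * (norm_out N (\<lambda>e. Z e t) v)\<^sup>2) \<le> \<eta>"
  shows "\<exists>C1 rate. 0 < C1 \<and> 0 < rate \<and> (\<forall>t\<in>{0..T}.
    L2_energy N \<delta> t \<le> C1 * exp (- rate * t) * L2_energy N \<delta> 0 + C1 * \<eta> / rate)"
proof -
  let ?H = "\<Sum>e\<in>edges N. hp e 0 + hm e (len N e)"
  \<comment> \<open>The strict inequalities on finitely many edges leave a common positive margin,
    which is the decay rate.\<close>
  obtain \<gamma> where \<gamma>: "0 < \<gamma>" "\<And>e. e \<in> edges N \<Longrightarrow>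
      \<gamma> \<le> 3/4 * \<psi> * c - \<epsilon> - (12 * nu N e * M + 4 * \<beta> * Mhat) * kappa N Bp Bm \<psi> e"
  proof (rule finite_positive_lower_bound)
    show "0 < 3/4 * \<psi> * c - \<epsilon> - (12 * nu N e * M + 4 * \<beta> * Mhat) * kappa N Bp Bm \<psi> e"
      if "e \<in> edges N" for e
      using \<psi>[OF that] by linarith
  qed simp_all
  obtain m where m: "0 < m" "\<And>e. e \<in> edges N \<Longrightarrow> m \<le> hp e (len N e) \<and> m \<le> hm e 0"
  proof (rule finite_positive_lower_bound)
    show "0 < min (hp e (len N e)) (hm e 0)" if "e \<in> edges N" for e
      using h_pos[OF that] by simp
  qed simp_all
  \<comment> \<open>After division by the smallest weight \<open>m\<close>, one constant has to
    cover the equivalence of the energies and the factor of \<open>\<eta>\<close>. The added 1 makes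
    it positive also without edges, where \<open>?H\<close> is 0.\<close>
  define C1 where "C1 = max ?H (5/4 * c * ?H) / m + 1"
  have H: "0 \<le> ?H" using h_pos by (intro sum_nonneg add_nonneg_nonneg) (auto simp: less_imp_le)
  then have "0 \<le> max ?H (5/4 * c * ?H) / m" using m by simp
  then have C1_pos: "0 < C1" by (simp add: C1_def)
  have "m * C1 = max ?H (5/4 * c * ?H) + m" using m by (simp add: C1_def distrib_left)
  then have "max ?H (5/4 * c * ?H) \<le> m * C1" using m(1) by linarith
  then have C1: "?H \<le> m * C1" "5/4 * c * ?H \<le> m * C1" by auto
  have "L2_energy N \<delta> t \<le> C1 * exp (- \<gamma> * t) * L2_energy N \<delta> 0 + C1 * \<eta> / \<gamma>" if t: "t \<in> {0..T}" for t
  proof -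
    have zero: "0 \<in> {0..T}" using T_pos by simp
    have E_nonneg: "0 \<le> L2_energy N \<delta> 0"
      unfolding L2_energy_def
    proof (rule sum_nonneg)
      fix e
      let ?f = "\<lambda>x. \<bar>fst (\<delta> e 0 x)\<bar>\<^sup>2 + \<bar>snd (\<delta> e 0 x)\<bar>\<^sup>2"
      \<comment> \<open>A function that is not integrable has integral 0, so a case distinction
        settles the sign.\<close>
      show "0 \<le> integral {0..len N e} ?f"
        by (cases "?f integrable_on {0..len N e}") (simp_all add: integral_nonneg not_integrable_integral)
    qed
    have "0 \<le> (\<Sum>v\<in>nodes N. 2 * (norm_out N (\<lambda>e. Z e t) v)\<^sup>2)" by (intro sum_nonneg) auto
    then have \<eta>: "0 \<le> \<eta>" using Z[OF t] by linarith
    have "m * L2_energy N \<delta> t \<le> exp (- \<gamma> * t) * (\<Sum>e\<in>edges N. lyapunov e 0) + 5/4 * c * ?H * \<eta> / \<gamma>"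
      using lyapunov_bounds(1)[OF m(2) t] lyapunov_decay[OF \<gamma> K C Z t] by linarith
    also have "\<dots> \<le> exp (- \<gamma> * t) * (m * C1 * L2_energy N \<delta> 0) + m * C1 * \<eta> / \<gamma>"
    proof (intro add_mono mult_left_mono divide_right_mono mult_right_mono)
      have "(\<Sum>e\<in>edges N. lyapunov e 0) \<le> ?H * L2_energy N \<delta> 0" by (rule lyapunov_bounds(2)[OF m(2) zero])
      also have "\<dots> \<le> m * C1 * L2_energy N \<delta> 0" using C1(1) E_nonneg by (rule mult_right_mono)
      finally show "(\<Sum>e\<in>edges N. lyapunov e 0) \<le> m * C1 * L2_energy N \<delta> 0" .
    qed (use C1 \<eta> \<gamma>(1) in auto)
    also have "\<dots> = m * (C1 * exp (- \<gamma> * t) * L2_energy N \<delta> 0 + C1 * \<eta> / \<gamma>)"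
      by (simp add: algebra_simps)
    finally show ?thesis using m(1) by (rule mult_left_le_imp_le)
  qed
  with C1_pos \<gamma>(1) show ?thesis by (intro exI[of _ C1] exI[of _ \<gamma>] conjI ballI)
qed

end

theorem theorem5p2:
  fixes N :: "('v, 'e) network"
    and p :: "real \<Rightarrow> real"
    and \<mu> :: "'v \<Rightarrow> real"
    and u :: "'v \<Rightarrow> real \<Rightarrow> real"
    and Z :: "'e \<Rightarrow> real \<Rightarrow> real \<Rightarrow> real \<times> real"
    and Bp Bm :: "'e \<Rightarrow> real"
    and J y z :: "'e \<Rightarrow> real \<Rightarrow> real \<times> real"
    and S R :: "'e \<Rightarrow> real \<Rightarrow> real \<Rightarrow> real \<times> real"
    and U :: "(real \<times> real) set"
    and M T Mhat c \<epsilon>\<^sub>0 \<beta> :: real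
  assumes "valid_network N"
    and "pressure_law p"
    and "\<forall>v\<in>nodes N. 0 \<le> \<mu> v \<and> \<mu> v \<le> 1"
    and "\<forall>v\<in>nodes N. card (E0 N v) = 1 \<longrightarrow> C1_on 0 T (u v)"
    and "\<forall>v\<in>nodes N. \<forall>e\<in>E0 N v. C1_on 0 T (\<lambda>t. Z e t (xend N v e))"
    and "\<forall>e\<in>edges N. 0 < Bp e \<and> 0 < Bm e"
    and "0 < M"
    and "steady_state_S N p \<mu> J"
    and "\<forall>e\<in>edges N. \<forall>x\<in>{0..len N e}.
           0 < lam_p p (J e x) \<and> lam_m p (J e x) < 0 \<and>
           0 < \<bar>fst (J e x) - snd (J e x)\<bar> \<and> \<bar>fst (J e x) - snd (J e x)\<bar> \<le> M"
    and "0 < T"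
    and "\<forall>e\<in>edges N. C1_on 0 (len N e) (y e) \<and> C1_on 0 (len N e) (z e)"
    and "C1_compatible_S N p \<mu> T u y"
    and "C1_compatible_R N p \<mu> T u Z y z"
    and "classical_S N p \<mu> T u y S"
    and "classical_R N p \<mu> T u Z S z R"
    and "\<forall>e\<in>edges N. C1_norm T (len N e) (\<lambda>t x. fst (S e t x) - fst (J e x)) \<le> M \<and>
           C1_norm T (len N e) (\<lambda>t x. snd (S e t x) - snd (J e x)) \<le> M"
    and "\<forall>e\<in>edges N. C1_norm T (len N e) (\<lambda>t x. fst (R e t x) - fst (J e x)) \<le> M \<and>
           C1_norm T (len N e) (\<lambda>t x. snd (R e t x) - snd (J e x)) \<le> M"
    and "0 < Mhat" and "0 < c" and "0 < \<epsilon>\<^sub>0"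
    and "\<forall>e\<in>edges N. \<forall>t\<in>{0..T}. \<forall>x\<in>{0..len N e}.
           \<bar>dx (len N e) (\<lambda>t x. fst (S e t x)) t x\<bar> \<le> Mhat \<and>
           \<bar>dx (len N e) (\<lambda>t x. snd (S e t x)) t x\<bar> \<le> Mhat \<and>
           3/4 * c \<le> lam_p p (R e t x) \<and> lam_p p (R e t x) \<le> 5/4 * c \<and>
           - (5/4) * c \<le> lam_m p (R e t x) \<and> lam_m p (R e t x) \<le> - (3/4) * c \<and>
           \<bar>dx (len N e) (\<lambda>t x. lam_p p (R e t x)) t x\<bar> \<le> \<epsilon>\<^sub>0 \<and>
           \<bar>dx (len N e) (\<lambda>t x. lam_m p (R e t x)) t x\<bar> \<le> \<epsilon>\<^sub>0"
    and "U \<noteq> {}" and "compact U" and "convex U" and "U \<subseteq> state_domain p"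
    and "\<forall>e\<in>edges N. \<forall>t\<in>{0..T}. \<forall>x\<in>{0..len N e}. S e t x \<in> U \<and> R e t x \<in> U"
    and "0 < \<beta>"
    and "\<forall>(a, b)\<in>U.
           \<bar>deriv (\<lambda>r. lam_p p (r, b)) a\<bar> \<le> \<beta> \<and> \<bar>deriv (\<lambda>r. lam_p p (a, r)) b\<bar> \<le> \<beta> \<and>
           \<bar>deriv (\<lambda>r. lam_m p (r, b)) a\<bar> \<le> \<beta> \<and> \<bar>deriv (\<lambda>r. lam_m p (a, r)) b\<bar> \<le> \<beta>"
  shows "\<exists>\<delta>. classical_Diff N p \<mu> T Z S y z \<delta> \<and>
    (\<forall>e\<in>edges N. \<forall>t\<in>{0..T}. \<forall>x\<in>{0..len N e}. \<delta> e t x = R e t x - S e t x) \<and>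
    (\<forall>\<psi> \<eta> Chat.
       0 < \<psi> \<and>
       (\<forall>e\<in>edges N. \<epsilon>\<^sub>0 + (12 * nu N e * M + 4 * \<beta> * Mhat) * kappa N Bp Bm \<psi> e < 3/4 * \<psi> * c) \<and>
       (\<forall>v\<in>nodes N. K_bound N v (Chat v)) \<and>
       (\<forall>v\<in>nodes N. E0 N v \<noteq> {} \<longrightarrow> (\<forall>t\<in>{0..T}.
          0 \<le> C_lower N p Bp Bm \<psi> R v t - 2 * C_upper N p Bp Bm \<psi> R v t * Chat v * \<bar>\<mu> v\<bar>\<^sup>2)) \<and>
       (\<forall>t\<in>{0..T}. (\<Sum>v\<in>nodes N. 2 * (norm_out N (\<lambda>e. Z e t) v)\<^sup>2) \<le> \<eta>) \<longrightarrow>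
       (\<exists>C1 rate. 0 < C1 \<and> 0 < rate \<and> (\<forall>t\<in>{0..T}.
          L2_energy N \<delta> t \<le> C1 * exp (- rate * t) * L2_energy N \<delta> 0 + C1 * \<eta> / rate)))"
proof -
  have J_le: "\<bar>fst (J e x) - snd (J e x)\<bar> \<le> M" if "e \<in> edges N" "x \<in> {0..len N e}" for e x
    using bspec[OF bspec[OF assms(9) that(1)] that(2)] by simp
  have deriv_le: "\<bar>deriv (\<lambda>r. lam_p p (r, b)) a\<bar> \<le> \<beta> \<and> \<bar>deriv (\<lambda>r. lam_p p (a, r)) b\<bar> \<le> \<beta> \<and>
      \<bar>deriv (\<lambda>r. lam_m p (r, b)) a\<bar> \<le> \<beta> \<and> \<bar>deriv (\<lambda>r. lam_m p (a, r)) b\<bar> \<le> \<beta>"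
    if "(a, b) \<in> U" for a b
    using bspec[OF assms(28) that] unfolding prod.case .
  interpret perturbed_flow N p \<mu> u Z J y z S R U M T Mhat c \<epsilon>\<^sub>0 \<beta>
    by unfold_locales (rule assms J_le deriv_le bspec[OF assms(3)] bspec[OF assms(16)] bspec[OF assms(17)]
        bspec[OF bspec[OF bspec[OF assms(21)]]] bspec[OF bspec[OF bspec[OF assms(26)]]] | assumption)+
  have decay: "\<exists>C1 rate. 0 < C1 \<and> 0 < rate \<and> (\<forall>t\<in>{0..T}.
      L2_energy N \<delta> t \<le> C1 * exp (- rate * t) * L2_energy N \<delta> 0 + C1 * \<eta> / rate)"
    if h: "0 < \<psi> \<and>
       (\<forall>e\<in>edges N. \<epsilon>\<^sub>0 + (12 * nu N e * M + 4 * \<beta> * Mhat) * kappa N Bp Bm \<psi> e < 3/4 * \<psi> * c) \<and>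
       (\<forall>v\<in>nodes N. K_bound N v (Chat v)) \<and>
       (\<forall>v\<in>nodes N. E0 N v \<noteq> {} \<longrightarrow> (\<forall>t\<in>{0..T}.
          0 \<le> C_lower N p Bp Bm \<psi> R v t - 2 * C_upper N p Bp Bm \<psi> R v t * Chat v * \<bar>\<mu> v\<bar>\<^sup>2)) \<and>
       (\<forall>t\<in>{0..T}. (\<Sum>v\<in>nodes N. 2 * (norm_out N (\<lambda>e. Z e t) v)\<^sup>2) \<le> \<eta>)" for \<psi> \<eta> Chat
  proof -
    \<comment> \<open>Only \<open>\<psi>\<close> and the weights are added here;
      \<open>\<delta>\<close> is still the one of the outer interpretation.\<close>
    interpret weighted_perturbed_flow N p \<mu> u Z J y z S R U M T Mhat c \<epsilon>\<^sub>0 \<beta> Bp Bm \<psi>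
      by unfold_locales (use assms(6) h in blast)+
    show ?thesis by (rule energy_decay[where Chat = Chat]) (use h in blast)+
  qed
  show ?thesis
  proof (intro exI[of _ \<delta>] conjI allI impI)
    show "classical_Diff N p \<mu> T Z S y z \<delta>" by (rule classical_Diff_\<delta>)
    show "\<forall>e\<in>edges N. \<forall>t\<in>{0..T}. \<forall>x\<in>{0..len N e}. \<delta> e t x = R e t x - S e t x"
      by (simp add: \<delta>_def)
  qed (rule decay)
qed

end
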